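(* Let $I,J\subseteq\{1,\dots,N-1\}$ be disjoint with $i-1,i+1\notin J$ for every $i\in I$ and $j-1,j+1\notin I$ for every $j\in J$. Let $\eta^*$ be a composition with $\eta^*_i\ge\eta^*_{i+1}$ for all $i\in I$ and $\eta^*_j>\eta^*_{j+1}$ for all $j\in J$. Then for all $i\in I\cup J$, $$s_i\big(O_JS^{(I,J)}_{\eta^*}(z)\big)=O_JS^{(I,J)}_{\eta^*}(z).$$ Moreover, with $$c_{\eta^*}:=\prod_{\vec\beta\in R_{J,+}}\big((\overline{\eta^*}_{\vec\beta}+1)/\alpha\big),$$ where $\overline{\eta^*}_{\vec\beta}:=\overline{\eta^*}_j-\overline{\eta^*}_k$ for $\vec\beta=\vec e_j-\vec e_k$, we have $$O_JS^{(I,J)}_{\eta^*}(z)=c_{\eta^*}\,S^{(I\cup J,\emptyset)}_{\eta^*}(z).$$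
   Context: Fix $N\ge 1$ and a real parameter $\alpha>0$. A composition is $\eta=(\eta_1,\dots,\eta_N)$ with nonnegative integer entries; $|\eta|=\sum_j\eta_j$; $\eta^+$ is the partition obtained by sorting the entries of $\eta$ in weakly decreasing order. For compositions $\nu\ne\eta$ with $|\nu|=|\eta|$, write $\nu<\eta$ if $\sum_{j=1}^p\nu_j\le\sum_{j=1}^p\eta_j$ for all $p=1,\dots,N$; write $\nu\prec\eta$ if $\nu^+<\eta^+$, or if $\nu^+=\eta^+$ and $\nu<\eta$. Let $s_{jk}$ be the operator interchanging $z_j$ and $z_k$ in a function of $z=(z_1,\dots,z_N)$, and $s_j:=s_{j,j+1}$. The Cherednik operators are $$\xi_i=\alpha z_i\frac{\partial}{\partial z_i}+\sum_{p<i}\frac{z_i}{z_i-z_p}(1-s_{ip})+\sum_{p>i}\frac{z_p}{z_i-z_p}(1-s_{ip})+1-i ,\quad i=1,\dots,N;$$ they commute with each other. The nonsymmetric Jack polynomial $E_\eta(z)=E_\eta(z;\alpha)$ is the unique polynomial of the form $z^\eta+\sum_{\nu\prec\eta}c_{\eta\nu}z^\nu$ with $\xi_iE_\eta=\bar\eta_iE_\eta$ for all $i$, where $\bar\eta_i:=\alpha\eta_i-\#\{k<i\mid\eta_k\ge\eta_i\}-\#\{k>i\mid\eta_k>\eta_i\}$ (so $\overline{\eta^*}_i$ is this quantity for $\eta^*$). For $K\subseteq\{1,\dots,N-1\}$, $W_K$ is the group generated by the transpositions $s_j$, $j\in K$, acting on compositions by $w(\lambda)=(\lambda_{w^{-1}(1)},\dots,\lambda_{w^{-1}(N)})$.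 Write $J=\bigcup_sJ_s$ as the union of its maximal sets of consecutive integers and $\tilde J_s:=J_s\cup\{\max(J_s)+1\}$. For $w\in W_{I\cup J}$, $\det_J(w)=+1$ or $-1$ according to whether an expression of $w$ as a product of the generators $s_k$, $k\in I\cup J$, has an even or odd number of factors from $\{s_j\mid j\in J\}$. The operator $\mathcal O_{I,J}$ is defined linearly by $\mathcal O_{I,J}(z^\lambda)=\sum_{w\in W_{I\cup J}}\det_J(w)\,z^{w(\lambda)}$. For $\eta^*$ with $\eta^*_i\ge\eta^*_{i+1}$ ($i\in I$), $\eta^*_j>\eta^*_{j+1}$ ($j\in J$), the Jack polynomial with prescribed symmetry $S^{(I,J)}_{\eta^*}(z)$ is the scalar multiple of $\mathcal O_{I,J}E_{\eta^*}(z)$ normalized so that $S^{(I,J)}_{\eta^*}(z)=z^{\eta^*}+\sum_{\nu\prec\eta^*}\tilde c_{\nu}z^\nu$. The polynomial $S^{(I\cup J,\emptyset)}_{\eta^*}$ is the same construction with $(I,J)$ replaced by $(I\cup J,\emptyset)$. With $\vec e_j$ the standard unit vectors of $\mathbb R^N$, let $R_{J,+}=\{\vec e_j-\vec e_k\mid 1\le j<k\le N,\ j,k\in\tilde J_s\text{ for some }s\}$. For $\vec\beta=\vec e_j-\vec e_k$ put $D_{\vec\beta}=\frac1\alpha(\xi_j-\xi_k)$, and define $$O_J:=\prod_{\vec\beta\in R_{J,+}}\Big(D_{\vec\beta}+\frac1\alpha\Big).$$ *)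

theory Defs
  imports Complex_Main "HOL-Library.Poly_Mapping" "HOL-Combinatorics.Transposition"
begin

text \<open>
  A composition \<open>\<eta>\<close> is a finitely supported map whose entries are indexed by \<open>1, \<dots>, N\<close>
  (everything outside that range, in particular index 0, is zero).  It serves at the same time as
  the exponent vector of the monomial \<open>z\<^sup>\<eta>\<close>; a polynomial maps exponent vectors to
  coefficients, with the convolution product of \<^theory>\<open>HOL-Library.Poly_Mapping\<close>.
\<close>

type_synonym comp = "nat \<Rightarrow>\<^sub>0 nat"
type_synonym mpol = "comp \<Rightarrow>\<^sub>0 real"

definition composition :: "nat \<Rightarrow> comp \<Rightarrow> bool" where
  "composition N \<eta> \<longleftrightarrow> Poly_Mapping.keys \<eta> \<subseteq> {1..N}"

definition weight :: "nat \<Rightarrow> comp \<Rightarrow> nat" where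
  "weight N \<eta> = (\<Sum>j=1..N. Poly_Mapping.lookup \<eta> j)"

text \<open>The leading \<open>0\<close> in the list occupies the unused index 0.\<close>

definition sorted_comp :: "nat \<Rightarrow> comp \<Rightarrow> comp" where
  "sorted_comp N \<eta> =
     Poly_Mapping.nth (0 # rev (sort (map (Poly_Mapping.lookup \<eta>) [1..<Suc N])))"

definition dom_less :: "nat \<Rightarrow> comp \<Rightarrow> comp \<Rightarrow> bool" where
  "dom_less N \<nu> \<eta> \<longleftrightarrow> \<nu> \<noteq> \<eta> \<and> weight N \<nu> = weight N \<eta> \<and>
     (\<forall>p\<in>{1..N}. (\<Sum>j=1..p. Poly_Mapping.lookup \<nu> j) \<le> (\<Sum>j=1..p. Poly_Mapping.lookup \<eta> j))"

definition prec :: "nat \<Rightarrow> comp \<Rightarrow> comp \<Rightarrow> bool" where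
  "prec N \<nu> \<eta> \<longleftrightarrow> composition N \<nu> \<and> composition N \<eta> \<and> \<nu> \<noteq> \<eta> \<and> weight N \<nu> = weight N \<eta> \<and>
     (dom_less N (sorted_comp N \<nu>) (sorted_comp N \<eta>) \<or>
      sorted_comp N \<nu> = sorted_comp N \<eta> \<and> dom_less N \<nu> \<eta>)"

definition Const :: "real \<Rightarrow> mpol" where
  "Const c = Poly_Mapping.single 0 c"

definition monom :: "comp \<Rightarrow> mpol" where
  "monom \<mu> = Poly_Mapping.single \<mu> 1"

definition Z :: "nat \<Rightarrow> mpol" where
  "Z i = monom (Poly_Mapping.single i 1)"

definition lin_ext :: "(comp \<Rightarrow> mpol) \<Rightarrow> mpol \<Rightarrow> mpol" where
  "lin_ext T f = (\<Sum>\<mu>\<in>Poly_Mapping.keys f. Const (Poly_Mapping.lookup f \<mu>) * T \<mu>)"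

text \<open>\<open>w(\<mu>)\<close> with entries \<open>w(\<mu>)\<^sub>i = \<mu>\<^bsub>w\<^sup>-\<^sup>1(i)\<^esub>\<close>, for a bijection \<open>w\<close>.\<close>

definition perm_comp :: "(nat \<Rightarrow> nat) \<Rightarrow> comp \<Rightarrow> comp" where
  "perm_comp w \<mu> = Poly_Mapping.map_key (inv w) \<mu>"

definition swap_vars :: "nat \<Rightarrow> nat \<Rightarrow> mpol \<Rightarrow> mpol" where
  "swap_vars j k = lin_ext (\<lambda>\<mu>. monom (perm_comp (transpose j k) \<mu>))"

text \<open>Truncated subtraction of exponents is harmless: the coefficient vanishes if \<open>\<mu>\<^sub>i = 0\<close>.\<close>

definition partial_deriv :: "nat \<Rightarrow> mpol \<Rightarrow> mpol" where
  "partial_deriv i = lin_ext (\<lambda>\<mu>. Const (real (Poly_Mapping.lookup \<mu> i)) *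
     monom (\<mu> - Poly_Mapping.single i 1))"

text \<open>The polynomial \<open>(z\<^sub>i - z\<^sub>p)\<^sup>-\<^sup>1 (1 - s\<^bsub>ip\<^esub>) f\<close>, for \<open>i \<noteq> p\<close>.\<close>

definition div_diff :: "nat \<Rightarrow> nat \<Rightarrow> mpol \<Rightarrow> mpol" where
  "div_diff i p f = (THE q. (Z i - Z p) * q = f - swap_vars i p f)"

definition cherednik :: "real \<Rightarrow> nat \<Rightarrow> nat \<Rightarrow> mpol \<Rightarrow> mpol" where
  "cherednik \<alpha> N i f =
     Const \<alpha> * Z i * partial_deriv i f
     + (\<Sum>p\<in>{1..<i}. Z i * div_diff i p f)
     + (\<Sum>p\<in>{i<..N}. Z p * div_diff i p f)
     + Const (1 - real i) * f"

definition eta_bar :: "real \<Rightarrow> nat \<Rightarrow> comp \<Rightarrow> nat \<Rightarrow> real" where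
  "eta_bar \<alpha> N \<eta> i =
     \<alpha> * real (Poly_Mapping.lookup \<eta> i)
     - real (card {k\<in>{1..<i}. Poly_Mapping.lookup \<eta> k \<ge> Poly_Mapping.lookup \<eta> i})
     - real (card {k\<in>{i<..N}. Poly_Mapping.lookup \<eta> k > Poly_Mapping.lookup \<eta> i})"

text \<open>Polynomials of the form \<open>z\<^sup>\<eta> + \<Sum>\<^bsub>\<nu> \<prec> \<eta>\<^esub> c\<^sub>\<nu> z\<^sup>\<nu>\<close>.\<close>

definition unitriangular :: "nat \<Rightarrow> comp \<Rightarrow> mpol \<Rightarrow> bool" where
  "unitriangular N \<eta> f \<longleftrightarrow> Poly_Mapping.lookup f \<eta> = 1 \<and>
     (\<forall>\<nu>\<in>Poly_Mapping.keys f. \<nu> \<noteq> \<eta> \<longrightarrow> prec N \<nu> \<eta>)"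

definition nonsym_jack :: "real \<Rightarrow> nat \<Rightarrow> comp \<Rightarrow> mpol" where
  "nonsym_jack \<alpha> N \<eta> =
     (THE f. unitriangular N \<eta> f \<and>
        (\<forall>i\<in>{1..N}. cherednik \<alpha> N i f = Const (eta_bar \<alpha> N \<eta> i) * f))"

definition word_perm :: "nat list \<Rightarrow> nat \<Rightarrow> nat" where
  "word_perm ks = foldr (\<lambda>k w. transpose k (Suc k) \<circ> w) ks id"

text \<open>The generators are involutions, so the group they generate consists of the words in them.\<close>

definition W :: "nat set \<Rightarrow> (nat \<Rightarrow> nat) set" where
  "W K = word_perm ` lists K"

definition det_sign :: "nat set \<Rightarrow> nat set \<Rightarrow> (nat \<Rightarrow> nat) \<Rightarrow> real" where
  "det_sign I J w =
     (if \<exists>ks\<in>lists (I \<union> J). w = word_perm ks \<and> even (length (filter (\<lambda>k. k \<in> J) ks))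
      then 1 else - 1)"

definition sym_op :: "nat set \<Rightarrow> nat set \<Rightarrow> mpol \<Rightarrow> mpol" where
  "sym_op I J = lin_ext (\<lambda>\<mu>. \<Sum>w\<in>W (I \<union> J). Const (det_sign I J w) * monom (perm_comp w \<mu>))"

definition jack_prescribed :: "real \<Rightarrow> nat \<Rightarrow> nat set \<Rightarrow> nat set \<Rightarrow> comp \<Rightarrow> mpol" where
  "jack_prescribed \<alpha> N I J \<eta> =
     (THE f. (\<exists>a. f = Const a * sym_op I J (nonsym_jack \<alpha> N \<eta>)) \<and> unitriangular N \<eta> f)"

definition consecutive :: "nat set \<Rightarrow> bool" where
  "consecutive B \<longleftrightarrow> (\<exists>a b. a \<le> b \<and> B = {a..b})"

definition blocks :: "nat set \<Rightarrow> nat set set" where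
  "blocks J = {B. consecutive B \<and> B \<subseteq> J \<and>
     (\<forall>B'. consecutive B' \<and> B \<subseteq> B' \<and> B' \<subseteq> J \<longrightarrow> B' = B)}"

definition ext_block :: "nat set \<Rightarrow> nat set" where
  "ext_block B = B \<union> {Max B + 1}"

text \<open>The root \<open>e\<^sub>j - e\<^sub>k\<close> is represented by the pair \<open>(j, k)\<close>.\<close>

definition pos_roots :: "nat \<Rightarrow> nat set \<Rightarrow> (nat \<times> nat) set" where
  "pos_roots N J = {(j, k). 1 \<le> j \<and> j < k \<and> k \<le> N \<and>
     (\<exists>B\<in>blocks J. j \<in> ext_block B \<and> k \<in> ext_block B)}"

definition D_root :: "real \<Rightarrow> nat \<Rightarrow> nat \<times> nat \<Rightarrow> mpol \<Rightarrow> mpol" where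
  "D_root \<alpha> N = (\<lambda>(j, k) f. Const (1 / \<alpha>) * (cherednik \<alpha> N j f - cherednik \<alpha> N k f))"

text \<open>
  The composition of the operators \<open>D\<^sub>\<beta> + 1/\<alpha>\<close> along a list of roots.  The product \<open>O\<^sub>J\<close> over the
  set of positive roots is obtained from any enumeration of that set, as the Cherednik operators
  commute.
\<close>

definition O_prod :: "real \<Rightarrow> nat \<Rightarrow> (nat \<times> nat) list \<Rightarrow> mpol \<Rightarrow> mpol" where
  "O_prod \<alpha> N \<beta>s = foldr (\<lambda>\<beta> g. (\<lambda>f. D_root \<alpha> N \<beta> f + Const (1 / \<alpha>) * f) \<circ> g) \<beta>s id"

definition c_coeff :: "real \<Rightarrow> nat \<Rightarrow> nat set \<Rightarrow> comp \<Rightarrow> real" where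
  "c_coeff \<alpha> N J \<eta> =
     (\<Prod>(j, k)\<in>pos_roots N J. (eta_bar \<alpha> N \<eta> j - eta_bar \<alpha> N \<eta> k + 1) / \<alpha>)"

end

theory Submission
  imports Defs "HOL-Combinatorics.Permutations"
begin

text \<open>
  The Cherednik operators are triangular on monomials for an order stronger than \<open>\<prec>\<close> that is the
  Bruhat order on each orbit of the symmetric group, and their joint eigenvalues separate
  compositions.  Hence every joint eigenfunction is determined by its leading monomial.  Existence of
  \<open>E\<^sub>\<eta>\<close> follows from the affine intertwiner and the intertwiners \<open>s\<^sub>k - 1/\<delta>\<close>.

  Let \<open>V\<close> be the span of the \<open>E\<^sub>\<mu>\<close> with \<open>\<mu>\<close> in the \<open>W\<^bsub>I \<union> J\<^esub>\<close>-orbit of \<open>\<eta>\<close>.  It is stable under \<open>s\<^sub>k\<close>,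
  \<open>k \<in> I \<union> J\<close>, and the \<open>\<xi>\<^sub>i\<close> act on it by commuting diagonal operators.  If \<open>F\<close> is the Jack polynomial with
  prescribed symmetry and \<open>k \<in> J\<close>, write \<open>O\<^sub>J F = (D + 1/\<alpha>) g\<close> with \<open>D\<close> the operator of the simple root
  \<open>e\<^sub>k - e\<^bsub>k+1\<^esub>\<close>.  The remaining factors are permuted by \<open>s\<^sub>k\<close>, so \<open>s\<^sub>k g = - g\<close>, and the relations between
  \<open>\<xi>\<^sub>k\<close>, \<open>\<xi>\<^bsub>k+1\<^esub>\<close> and \<open>s\<^sub>k\<close> give the symmetry of \<open>O\<^sub>J F\<close>.  By triangularity a symmetric element of \<open>V\<close> is
  determined by its coefficient at \<open>z\<^sup>\<eta>\<close>, which identifies \<open>O\<^sub>J F\<close>.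
\<close>

section \<open>Linear operators on polynomials\<close>

text \<open>Three objects of the statement are definite descriptions: the quotient
  \<open>div_diff\<close>, the polynomial \<open>nonsym_jack\<close> and the normalized
  \<open>jack_prescribed\<close>. Each needs existence and uniqueness before anything can be
  computed. For the last one the danger is that the leading coefficient vanishes under signed
  symmetrization. Two facts prevent this: strict descent of \<eta> along J makes det_J trivial on
  its stabilizer, and \<alpha> > 0 forces an eigenvalue gap below -1 at every ascent, so the factors
  met on the way through the orbit are nonzero. Dominance is too weak for the orbit argument: the
  compositions below \<eta> need not be stable under s_k even if \<eta> descends weakly at k. The
  Bruhat order has this stability. The shift 1/\<alpha> in O_J is forced by a single simple root: if
  s_k g = -g and d = xi_k - xi_(k+1), the relations give s_k (d g) = d g + 2 g, and d g + g is the
  combination that s_k fixes.\<close>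

abbreviation (input) look :: "('a \<Rightarrow>\<^sub>0 'b::zero) \<Rightarrow> 'a \<Rightarrow> 'b" where
  "look \<equiv> Poly_Mapping.lookup"

abbreviation (input) supp :: "('a \<Rightarrow>\<^sub>0 'b::zero) \<Rightarrow> 'a set" where
  "supp \<equiv> Poly_Mapping.keys"

text \<open>Scalars act through constant polynomials, which makes the library theory of spans and
  subspaces available here.\<close>

interpretation mpol: vector_space "\<lambda>c (f::mpol). Const c * f"
  by standard (simp_all add: Const_def algebra_simps single_add mult_single flip: single_one)

lemma look_Const_mult [simp]: "look (Const c * f) \<mu> = c * look f \<mu>"
  unfolding Const_def mult_map_scale_conv_mult[symmetric]
  by (simp add: Poly_Mapping.map.rep_eq when_def)

lemma look_sum: "look (\<Sum>x\<in>A. f x) \<mu> = (\<Sum>x\<in>A. look (f x) \<mu>)"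
  by (induction A rule: infinite_finite_induct) (simp_all add: lookup_add)

lemma Const_1 [simp]: "Const 1 = 1"
  by (simp add: Const_def flip: single_one)

lemma Const_0 [simp]: "Const 0 = 0"
  by (simp add: Const_def)

lemma Const_add: "Const (a + b) = Const a + Const b"
  by (simp add: Const_def single_add)

lemma Const_diff: "Const (a - b) = Const a - Const b"
  by (simp add: Const_def single_diff)

lemma Const_minus: "Const (- a) = - Const a"
  by (simp add: Const_def single_uminus)

lemma Const_mult: "Const (a * b) = Const a * Const b"
  by (simp add: Const_def mult_single)

lemma Const_neg_1 [simp]: "Const (- 1) = - 1"
  by (simp add: Const_minus)

lemma look_monom: "look (monom \<mu>) \<nu> = (if \<mu> = \<nu> then 1 else 0)"
  by (simp add: monom_def lookup_single when_def)

lemma monom_add: "monom (\<mu> + \<nu>) = monom \<mu> * monom \<nu>"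
  by (simp add: monom_def mult_single)

lemma mpol_expand: "f = (\<Sum>\<mu>\<in>supp f. Const (look f \<mu>) * monom \<mu>)"
  by (rule poly_mapping_eqI) (auto simp: look_sum look_monom in_keys_iff if_distrib sum.If_cases cong: if_cong)

lemma span_monom: "f \<in> mpol.span (monom ` supp f)"
  by (subst mpol_expand) (intro mpol.span_sum mpol.span_scale mpol.span_base imageI)

definition lin :: "(mpol \<Rightarrow> mpol) \<Rightarrow> bool" where
  "lin T \<longleftrightarrow> (\<forall>f g. T (f + g) = T f + T g) \<and> (\<forall>c f. T (Const c * f) = Const c * T f)"

lemma linI: "(\<And>f g. T (f + g) = T f + T g) \<Longrightarrow> (\<And>c f. T (Const c * f) = Const c * T f) \<Longrightarrow> lin T"
  by (simp add: lin_def)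

lemma lin_add: "lin T \<Longrightarrow> T (f + g) = T f + T g"
  and lin_scale: "lin T \<Longrightarrow> T (Const c * f) = Const c * T f"
  by (simp_all add: lin_def)

lemma lin_0: "lin T \<Longrightarrow> T 0 = 0"
  using lin_scale[of T 0 0] by simp

lemma lin_minus: "lin T \<Longrightarrow> T (- f) = - T f"
  using lin_scale[of T "-1" f] by simp

lemma lin_diff: "lin T \<Longrightarrow> T (f - g) = T f - T g"
  using lin_add[of T f "- g"] by (simp add: lin_minus)

lemma lin_sum: "lin T \<Longrightarrow> T (\<Sum>x\<in>A. f x) = (\<Sum>x\<in>A. T (f x))"
  by (induction A rule: infinite_finite_induct) (simp_all add: lin_0 lin_add)

lemma lin_id: "lin (\<lambda>f. f)"
  and lin_mult: "lin T \<Longrightarrow> lin (\<lambda>f. g * T f)"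
  and lin_plus: "lin T \<Longrightarrow> lin S \<Longrightarrow> lin (\<lambda>f. T f + S f)"
  and lin_sub: "lin T \<Longrightarrow> lin S \<Longrightarrow> lin (\<lambda>f. T f - S f)"
  by (simp_all add: lin_def algebra_simps)

lemma lin_comp: "lin T \<Longrightarrow> lin S \<Longrightarrow> lin (\<lambda>f. T (S f))"
  by (simp add: lin_def)

lemma lin_Sum: "(\<And>x. x \<in> A \<Longrightarrow> lin (T x)) \<Longrightarrow> lin (\<lambda>f. \<Sum>x\<in>A. T x f)"
  by (simp add: lin_def sum.distrib sum_distrib_left)

named_theorems lin_intros
declare lin_id [lin_intros] lin_mult [lin_intros] lin_plus [lin_intros] lin_sub [lin_intros] lin_Sum [lin_intros]

lemma lin_eq_on_span:
  assumes "lin T" "lin S" "\<And>x. x \<in> B \<Longrightarrow> T x = S x" "f \<in> mpol.span B"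
  shows "T f = S f"
  using assms(4)
proof (induction rule: mpol.span_induct_alt)
  case base
  then show ?case using assms(1,2) by (simp add: lin_0)
next
  case (step c x y)
  then show ?case using assms by (simp add: lin_add lin_scale)
qed

text \<open>Monomials span, so identities between operators reduce to computations with
  exponents.\<close>

lemma lin_eqI:
  assumes "lin T" "lin S" "\<And>\<mu>. T (monom \<mu>) = S (monom \<mu>)"
  shows "T f = S f"
  using lin_eq_on_span[OF assms(1,2) _ span_monom[of f]] assms(3) by blast

lemma lin_span_closed:
  assumes "lin T" "\<And>x. x \<in> B \<Longrightarrow> T x \<in> mpol.span B" "f \<in> mpol.span B"
  shows "T f \<in> mpol.span B"
  using assms(3)
proof (induction rule: mpol.span_induct_alt)
  case base
  then show ?case using assms(1) by (simp add: lin_0 mpol.span_zero)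
next
  case (step c x y)
  then show ?case using assms by (simp add: lin_add lin_scale mpol.span_add mpol.span_scale)
qed

lemma lin_ext_superset:
  assumes "finite A" "supp f \<subseteq> A"
  shows "lin_ext T f = (\<Sum>\<mu>\<in>A. Const (look f \<mu>) * T \<mu>)"
  unfolding lin_ext_def using assms by (intro sum.mono_neutral_left) (auto simp: in_keys_iff)

lemma lin_lin_ext: "lin (lin_ext T)"
proof (rule linI)
  fix f g :: mpol and c
  let ?A = "supp f \<union> supp g"
  have A: "lin_ext T h = (\<Sum>\<mu>\<in>?A. Const (look h \<mu>) * T \<mu>)" if "supp h \<subseteq> ?A" for h
    using that by (intro lin_ext_superset) auto
  show "lin_ext T (f + g) = lin_ext T f + lin_ext T g"
    by (simp add: A keys_add lookup_add Const_add distrib_right sum.distrib)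
  have "supp (Const c * f) \<subseteq> ?A" by (auto simp: in_keys_iff)
  then show "lin_ext T (Const c * f) = Const c * lin_ext T f"
    by (simp add: A sum_distrib_left)
qed

lemma lin_ext_monom [simp]: "lin_ext T (monom \<mu>) = T \<mu>"
  by (simp add: lin_ext_def monom_def)

section \<open>The action of permutations on polynomials\<close>

definition act :: "(nat \<Rightarrow> nat) \<Rightarrow> mpol \<Rightarrow> mpol" where
  "act w = lin_ext (\<lambda>\<mu>. monom (perm_comp w \<mu>))"

lemma lin_act: "lin (act w)"
  by (simp add: act_def lin_lin_ext)

lemmas lin_act' [lin_intros] = lin_comp[OF lin_act]

lemmas act_linear [simp] = lin_add[OF lin_act] lin_scale[OF lin_act] lin_diff[OF lin_act] lin_minus[OF lin_act]
  lin_0[OF lin_act] lin_sum[OF lin_act]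

lemma act_monom: "act w (monom \<mu>) = monom (perm_comp w \<mu>)"
  by (simp add: act_def)

lemma swap_vars_act: "swap_vars j k = act (transpose j k)"
  by (simp add: swap_vars_def act_def)

lemma look_perm_comp: "bij w \<Longrightarrow> look (perm_comp w \<mu>) i = look \<mu> (inv w i)"
  by (simp add: perm_comp_def map_key.rep_eq bij_is_inj bij_imp_bij_inv)

lemma perm_comp_add: "bij w \<Longrightarrow> perm_comp w (\<mu> + \<nu>) = perm_comp w \<mu> + perm_comp w \<nu>"
  by (rule poly_mapping_eqI) (simp add: look_perm_comp lookup_add)

lemma perm_comp_comp:
  assumes "bij v" "bij w"
  shows "perm_comp v (perm_comp w \<mu>) = perm_comp (v \<circ> w) \<mu>"
  using assms by (intro poly_mapping_eqI) (simp add: look_perm_comp bij_comp o_inv_distrib)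

lemma perm_comp_id [simp]: "perm_comp id \<mu> = \<mu>"
  by (rule poly_mapping_eqI) (simp add: look_perm_comp)

lemma perm_comp_inv: "bij w \<Longrightarrow> perm_comp w (perm_comp (inv w) \<mu>) = \<mu>"
  and perm_comp_inv': "bij w \<Longrightarrow> perm_comp (inv w) (perm_comp w \<mu>) = \<mu>"
  by (simp_all add: perm_comp_comp bij_imp_bij_inv surj_iff[THEN iffD1, OF bij_is_surj] bij_is_inj)

lemma perm_comp_eq_iff: "bij w \<Longrightarrow> perm_comp w \<mu> = \<nu> \<longleftrightarrow> \<mu> = perm_comp (inv w) \<nu>"
  using perm_comp_inv perm_comp_inv' by metis

lemma look_act: "bij w \<Longrightarrow> look (act w f) \<mu> = look f (perm_comp (inv w) \<mu>)"
proof -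
  assume w: "bij w"
  have "look (act w f) \<mu> = (\<Sum>\<nu>\<in>supp f. look f \<nu> * (if \<nu> = perm_comp (inv w) \<mu> then 1 else 0))"
    by (simp add: act_def lin_ext_def look_sum look_monom perm_comp_eq_iff[OF w])
  also have "\<dots> = look f (perm_comp (inv w) \<mu>)"
    by (simp add: if_distrib sum.If_cases in_keys_iff cong: if_cong)
  finally show ?thesis .
qed

lemma act_comp: "bij v \<Longrightarrow> bij w \<Longrightarrow> act v (act w f) = act (v \<circ> w) f"
  by (rule poly_mapping_eqI)
    (simp add: look_act bij_comp perm_comp_comp bij_imp_bij_inv o_inv_distrib)

lemma act_id [simp]: "act id f = f"
  by (rule poly_mapping_eqI) (simp add: look_act)

lemma act_mult: "bij w \<Longrightarrow> act w (f * g) = act w f * act w g"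
\<comment> \<open>Both sides are bilinear, so the extension from monomials is applied once in each
  factor.\<close>
proof -
  assume w: "bij w"
  have 1: "act w (monom \<mu> * g) = act w (monom \<mu>) * act w g" for \<mu>
    by (rule lin_eqI[of "\<lambda>g. act w (monom \<mu> * g)" "\<lambda>g. act w (monom \<mu>) * act w g" g])
      (auto intro!: lin_intros simp: act_monom perm_comp_add w monom_add[symmetric])
  have 2: "act w (g * monom \<mu>) = act w g * act w (monom \<mu>)" for \<mu>
    using 1[of \<mu>] by (simp only: mult.commute)
  have "act w (g * f) = act w g * act w f"
    by (rule lin_eqI[of "\<lambda>f. act w (g * f)" "\<lambda>f. act w g * act w f" f])
      (auto intro!: lin_intros simp: 2)
  then show ?thesis by (simp add: mult.commute)
qed

lemma perm_comp_single: "bij w \<Longrightarrow> perm_comp w (Poly_Mapping.single i a) = Poly_Mapping.single (w i) a"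
  by (rule poly_mapping_eqI) (auto simp: look_perm_comp lookup_single when_def bij_inv_eq_iff)

lemma act_Z: "bij w \<Longrightarrow> act w (Z i) = Z (w i)"
  by (simp add: Z_def act_monom perm_comp_single)

lemma act_transpose_conj:
  "bij w \<Longrightarrow> act w (act (transpose a b) f) = act (transpose (w a) (w b)) (act w f)"
  by (simp add: act_comp bij_comp) 
    (rule arg_cong[of _ _ "\<lambda>v. act v f"], auto simp: fun_eq_iff transpose_def bij_is_inj[THEN inj_eq])

lemma act_transpose_transpose [simp]: "act (transpose a b) (act (transpose a b) f) = f"
  by (simp add: act_comp)

section \<open>Partial derivatives\<close>

lemma lin_partial_deriv: "lin (partial_deriv i)"
  by (simp add: partial_deriv_def lin_lin_ext)

lemmas lin_partial_deriv' [lin_intros] = lin_comp[OF lin_partial_deriv]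

lemma partial_deriv_act:
  assumes w: "bij w"
  shows "partial_deriv (w i) (act w f) = act w (partial_deriv i f)"
proof (rule lin_eqI[of "\<lambda>f. partial_deriv (w i) (act w f)" "\<lambda>f. act w (partial_deriv i f)" f])
  fix \<mu>
  have "perm_comp w (\<mu> - Poly_Mapping.single i 1) = perm_comp w \<mu> - Poly_Mapping.single (w i) 1"
    using w by (intro poly_mapping_eqI) (auto simp: look_perm_comp lookup_minus lookup_single when_def bij_inv_eq_iff)
  then show "partial_deriv (w i) (act w (monom \<mu>)) = act w (partial_deriv i (monom \<mu>))"
    by (simp add: act_monom partial_deriv_def look_perm_comp w inv_f_f bij_is_inj)
qed (auto intro!: lin_intros)

lemma Z_monom: "Z k * monom \<mu> = monom (\<mu> + Poly_Mapping.single k 1)"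
  by (simp add: Z_def monom_add mult.commute)

lemma partial_deriv_Z:
  "partial_deriv i (Z k * f) = Z k * partial_deriv i f + (if k = i then f else 0)"
proof -
  have "partial_deriv i (Z k * f) = Z k * partial_deriv i f + Const (if k = i then 1 else 0) * f"
  proof (rule lin_eqI[of "\<lambda>f. partial_deriv i (Z k * f)"
      "\<lambda>f. Z k * partial_deriv i f + Const (if k = i then 1 else 0) * f" f])
    fix \<mu> :: comp
    consider "k = i" | "k \<noteq> i" "look \<mu> i = 0" | "k \<noteq> i" "look \<mu> i > 0" by blast
    then show "partial_deriv i (Z k * monom \<mu>) = Z k * partial_deriv i (monom \<mu>) + Const (if k = i then 1 else 0) * monom \<mu>"
    proof cases
      case 1
      \<comment> \<open>Truncated subtraction breaks the identity of exponents when the i-th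
        exponent is 0. The coefficient vanishes in exactly that case, so it has to be kept in the
        equation.\<close>
      have "Const (real (look \<mu> i)) * monom (\<mu> - Poly_Mapping.single i 1 + Poly_Mapping.single i 1)
          = Const (real (look \<mu> i)) * monom \<mu>"
      proof (cases "look \<mu> i = 0")
        case False
        then have "\<mu> - Poly_Mapping.single i 1 + Poly_Mapping.single i 1 = \<mu>"
          by (intro poly_mapping_eqI) (auto simp: lookup_minus lookup_add lookup_single when_def)
        then show ?thesis by simp
      qed simp
      then show ?thesis using 1
        by (auto simp: Z_monom partial_deriv_def mult.left_commute[of "Z i"] lookup_add Const_add distrib_right)
    next
      case 3
      then have "\<mu> + Poly_Mapping.single k 1 - Poly_Mapping.single i 1 = \<mu> - Poly_Mapping.single i 1 + Poly_Mapping.single k 1"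
        by (intro poly_mapping_eqI) (auto simp: lookup_minus lookup_add lookup_single when_def)
      with 3 show ?thesis by (simp add: Z_monom partial_deriv_def mult.left_commute[of "Z k"] lookup_add lookup_single)
    qed (simp add: Z_monom partial_deriv_def lookup_add lookup_single)
  qed (auto intro!: lin_intros)
  then show ?thesis by simp
qed

lemma Z_neq: "i \<noteq> p \<Longrightarrow> Z i - Z p \<noteq> 0"
proof
  assume "i \<noteq> p" "Z i - Z p = 0"
  then have "look (Z i) (Poly_Mapping.single i 1) = look (Z p) (Poly_Mapping.single i 1)" by simp
  then have "look (Poly_Mapping.single p (1::nat)) i = look (Poly_Mapping.single i 1) i"
    by (simp add: Z_def look_monom split: if_splits)
  then show False using \<open>i \<noteq> p\<close> by (simp add: lookup_single)
qed

section \<open>Cherednik operators and the degenerate affine Hecke algebra\<close>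

text \<open>Polynomials have no zero divisors, so the quotient is unique. Later formulas for
  \<open>div_diff\<close> are verified by multiplying out.\<close>

lemma div_diff_unique:
  assumes "i \<noteq> p" "(Z i - Z p) * q = f - act (transpose i p) f"
  shows "div_diff i p f = q"
  unfolding div_diff_def swap_vars_act
proof (rule the_equality)
  fix q' assume "(Z i - Z p) * q' = f - act (transpose i p) f"
  with assms show "q' = q" using Z_neq[OF assms(1)] by (metis mult_left_cancel)
qed (use assms in simp)

text \<open>The divided difference of a monomial is a geometric sum in two variables; this names the
  exponents of its terms.\<close>

definition exps :: "nat \<Rightarrow> nat \<Rightarrow> comp \<Rightarrow> nat \<Rightarrow> nat \<Rightarrow> comp" where
  "exps i p \<mu> x y = Poly_Mapping.update i x (Poly_Mapping.update p y \<mu>)"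

lemma look_exps: "look (exps i p \<mu> x y) j = (if j = i then x else if j = p then y else look \<mu> j)"
  by (simp add: exps_def lookup_update)

lemma exps_self: "exps i p \<mu> (look \<mu> i) (look \<mu> p) = \<mu>"
  by (rule poly_mapping_eqI) (simp add: look_exps)

lemma exps_swap: "i \<noteq> p \<Longrightarrow> exps i p \<mu> (look \<mu> p) (look \<mu> i) = perm_comp (transpose i p) \<mu>"
  by (rule poly_mapping_eqI) (auto simp: look_exps look_perm_comp transpose_def)

lemma Z_exps1: "i \<noteq> p \<Longrightarrow> Z i * monom (exps i p \<mu> x y) = monom (exps i p \<mu> (Suc x) y)"
  and Z_exps2: "i \<noteq> p \<Longrightarrow> Z p * monom (exps i p \<mu> x y) = monom (exps i p \<mu> x (Suc y))"
  unfolding Z_monom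
  by (rule arg_cong[of _ _ monom], rule poly_mapping_eqI, auto simp: look_exps lookup_add lookup_single when_def)+

text \<open>Telescoping: (x - y) times the sum of x^(b+m) y^(a-1-m) over m < a - b is x^a y^b - x^b
  y^a.\<close>

lemma div_diff_monom_aux:
  assumes "i \<noteq> p" "b \<le> a"
  shows "(Z i - Z p) * (\<Sum>m<a - b. monom (exps i p \<mu> (b + m) (a - Suc m))) =
    monom (exps i p \<mu> a b) - monom (exps i p \<mu> b a)"
proof -
  define F where "F m = monom (exps i p \<mu> (b + m) (a - m))" for m
  have "(Z i - Z p) * (\<Sum>m<a - b. monom (exps i p \<mu> (b + m) (a - Suc m))) = (\<Sum>m<a - b. F (Suc m) - F m)"
    unfolding sum_distrib_left
  proof (rule sum.cong)
    fix m assume "m \<in> {..<a - b}"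
    then have "Suc (a - Suc m) = a - m" by auto
    then show "(Z i - Z p) * monom (exps i p \<mu> (b + m) (a - Suc m)) = F (Suc m) - F m"
      by (simp add: left_diff_distrib Z_exps1 Z_exps2 assms F_def)
  qed simp
  also have "\<dots> = F (a - b) - F 0" by (rule sum_lessThan_telescope)
  finally show ?thesis using assms by (simp add: F_def)
qed

lemma div_diff_monom_ge:
  assumes "i \<noteq> p" "look \<mu> p \<le> look \<mu> i"
  shows "div_diff i p (monom \<mu>) =
    (\<Sum>m<look \<mu> i - look \<mu> p. monom (exps i p \<mu> (look \<mu> p + m) (look \<mu> i - Suc m)))"
  by (rule div_diff_unique[OF assms(1)])
    (simp add: div_diff_monom_aux assms exps_self exps_swap act_monom)

lemma div_diff_monom_le:
  assumes "i \<noteq> p" "look \<mu> i \<le> look \<mu> p"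
  shows "div_diff i p (monom \<mu>) =
    - (\<Sum>m<look \<mu> p - look \<mu> i. monom (exps i p \<mu> (look \<mu> i + m) (look \<mu> p - Suc m)))"
  by (rule div_diff_unique[OF assms(1)])
    (simp add: div_diff_monom_aux assms exps_self exps_swap act_monom)

text \<open>Divisibility of f - s_ip f by z_i - z_p is stable under linear combinations, and on
  monomials the geometric sum is the quotient, up to a sign given by which exponent is
  larger.\<close>

lemma div_diff_mult:
  assumes "i \<noteq> p"
  shows "(Z i - Z p) * div_diff i p f = f - act (transpose i p) f"
proof -
  have "\<exists>q. (Z i - Z p) * q = f - act (transpose i p) f"
    using span_monom[of f]
  proof (induction rule: mpol.span_induct_alt)
    case base
    show ?case by (rule exI[of _ 0]) simp
  next
    case (step c x y)
    obtain q where q: "(Z i - Z p) * q = y - act (transpose i p) y" using step by blast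
    obtain r where r: "(Z i - Z p) * r = x - act (transpose i p) x"
    proof -
      obtain \<mu> where x: "x = monom \<mu>" using step by blast
      show ?thesis
      proof (cases "look \<mu> p \<le> look \<mu> i")
        case True
        from div_diff_monom_aux[OF assms True, of \<mu>] show ?thesis
          using that unfolding exps_self exps_swap[OF assms] x act_monom by blast
      next
        case False
        then have "look \<mu> i \<le> look \<mu> p" by simp
        from div_diff_monom_aux[OF assms this, of \<mu>] obtain q
          where "(Z i - Z p) * q = act (transpose i p) x - x"
          unfolding exps_self exps_swap[OF assms] x act_monom by blast
        then show ?thesis using that[of "- q"] by simp
      qed
    qed
    have "(Z i - Z p) * (Const c * r + q) = Const c * ((Z i - Z p) * r) + (Z i - Z p) * q"
      by (simp only: algebra_simps)
    also have "\<dots> = Const c * x + y - act (transpose i p) (Const c * x + y)"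
      by (simp add: q r right_diff_distrib)
    finally show ?case by blast
  qed
  then show ?thesis using div_diff_unique[OF assms] by metis
qed

lemma lin_div_diff: "i \<noteq> p \<Longrightarrow> lin (div_diff i p)"
proof (intro linI div_diff_unique)
  fix f g c assume "i \<noteq> p"
  show "(Z i - Z p) * (div_diff i p f + div_diff i p g) = f + g - act (transpose i p) (f + g)"
    by (simp only: distrib_left div_diff_mult[OF \<open>i \<noteq> p\<close>] act_linear) (simp add: algebra_simps)
  show "(Z i - Z p) * (Const c * div_diff i p f) = Const c * f - act (transpose i p) (Const c * f)"
    by (simp only: mult.left_commute[of _ "Const c"] div_diff_mult[OF \<open>i \<noteq> p\<close>] act_linear right_diff_distrib)
qed auto

lemmas lin_div_diff' [lin_intros] = lin_comp[OF lin_div_diff]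

lemma div_diff_act:
  assumes w: "bij w" and ip: "i \<noteq> p"
  shows "div_diff (w i) (w p) (act w f) = act w (div_diff i p f)"
proof (rule div_diff_unique)
  show "w i \<noteq> w p" using w ip by (simp add: bij_is_inj[THEN inj_eq])
  have "(Z (w i) - Z (w p)) * act w (div_diff i p f) = act w ((Z i - Z p) * div_diff i p f)"
    by (simp add: act_mult act_Z w)
  also have "\<dots> = act w f - act (transpose (w i) (w p)) (act w f)"
    by (simp add: div_diff_mult ip act_transpose_conj w)
  finally show "(Z (w i) - Z (w p)) * act w (div_diff i p f) = act w f - act (transpose (w i) (w p)) (act w f)" .
qed

text \<open>A twisted Leibniz rule: the divided difference of z_k itself is 1, -1 or 0, and it
  multiplies the swapped f.\<close>

lemma div_diff_Z:
  assumes "i \<noteq> p"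
  shows "div_diff i p (Z k * f) = Z k * div_diff i p f +
    (if k = i then act (transpose i p) f else if k = p then - act (transpose i p) f else 0)"
    (is "_ = Z k * _ + ?c")
proof (rule div_diff_unique[OF assms])
  have "(Z i - Z p) * (Z k * div_diff i p f + ?c) = Z k * (f - act (transpose i p) f) + (Z i - Z p) * ?c"
    by (simp only: distrib_left mult.left_commute[of _ "Z k"] div_diff_mult[OF assms])
  also have "\<dots> = Z k * f - act (transpose i p) (Z k * f)"
    by (auto simp: act_mult act_Z algebra_simps transpose_def)
  finally show "(Z i - Z p) * (Z k * div_diff i p f + ?c) = Z k * f - act (transpose i p) (Z k * f)" .
qed

text \<open>Up to a constant, \<open>\<xi>\<^sub>i\<close> differs from \<open>dunkl \<alpha> N i\<close> by \<open>\<Sum>\<^bsub>p>i\<^esub> s\<^bsub>ip\<^esub>\<close>; the operators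
  \<open>dunkl \<alpha> N i\<close> are permuted by the symmetric group, which makes all relations short computations.\<close>

definition dunkl :: "real \<Rightarrow> nat \<Rightarrow> nat \<Rightarrow> mpol \<Rightarrow> mpol" where
  "dunkl \<alpha> N i f = Const \<alpha> * (Z i * partial_deriv i f) + (\<Sum>p\<in>{1..N} - {i}. Z i * div_diff i p f)"

text \<open>For p > i one has z_p = z_i - (z_i - z_p), so each such term becomes a term of
  \<open>dunkl\<close> minus (1 - s_ip). The N - i copies of f that split off turn the constant 1 -
  i into 1 - N, which is the same for all i.\<close>

lemma cherednik_eq:
  assumes i: "i \<in> {1..N}"
  shows "cherednik \<alpha> N i f =
    dunkl \<alpha> N i f + (\<Sum>p\<in>{i<..N}. act (transpose i p) f) + Const (1 - real N) * f"
proof -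
  have *: "Z p * div_diff i p f = Z i * div_diff i p f - f + act (transpose i p) f" if "p \<in> {i<..N}" for p
    using div_diff_mult[of i p f] that by (simp add: algebra_simps)
  have N: "{1..N} - {i} = {1..<i} \<union> {i<..N}" using i by auto
  have D: "(\<Sum>p\<in>{1..N} - {i}. Z i * div_diff i p f)
      = (\<Sum>p\<in>{1..<i}. Z i * div_diff i p f) + (\<Sum>p\<in>{i<..N}. Z i * div_diff i p f)"
    unfolding N by (rule sum.union_disjoint) auto
  have "(\<Sum>p\<in>{i<..N}. Z p * div_diff i p f)
      = (\<Sum>p\<in>{i<..N}. Z i * div_diff i p f) - of_nat (N - i) * f + (\<Sum>p\<in>{i<..N}. act (transpose i p) f)"
    by (simp add: * sum.distrib sum_subtractf)
  moreover have "of_nat n = Const (real n)" for n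
    by (induction n) (simp_all add: Const_add)
  ultimately have E: "(\<Sum>p\<in>{i<..N}. Z p * div_diff i p f)
      = (\<Sum>p\<in>{i<..N}. Z i * div_diff i p f) - Const (real (N - i)) * f + (\<Sum>p\<in>{i<..N}. act (transpose i p) f)"
    by simp
  have "Const (1 - real i) = Const (1 - real N) + Const (real (N - i))"
    using i by (simp add: of_nat_diff flip: Const_add)
  then have F: "Const (1 - real i) * f = Const (1 - real N) * f + Const (real (N - i)) * f"
    by (simp only: distrib_right)
  have *: "a + b + (c - d + t) + (e + d) = a + (b + c) + t + e" for a b c d e t :: mpol
    by simp
  show ?thesis unfolding cherednik_def dunkl_def D E F mult.assoc by (rule *)
qed

lemma lin_cherednik: "lin (cherednik \<alpha> N i)"
  unfolding cherednik_def by (auto intro!: lin_intros)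

lemmas lin_cherednik' [lin_intros] = lin_comp[OF lin_cherednik]

lemma dunkl_act:
  assumes w: "w permutes {1..N}"
  shows "dunkl \<alpha> N (w i) (act w f) = act w (dunkl \<alpha> N i f)"
proof -
  note b = permutes_bij[OF w]
  have "w ` ({1..N} - {i}) = {1..N} - {w i}"
    using image_set_diff[OF permutes_inj[OF w], of "{1..N}" "{i}"] permutes_image[OF w] by simp
  then have bij: "bij_betw w ({1..N} - {i}) ({1..N} - {w i})"
    using permutes_inj_on[OF w] by (simp add: bij_betw_def)
  have "(\<Sum>p\<in>{1..N} - {w i}. Z (w i) * div_diff (w i) p (act w f))
      = (\<Sum>p\<in>{1..N} - {i}. Z (w i) * div_diff (w i) (w p) (act w f))"
    by (rule sum.reindex_bij_betw[symmetric]) (rule bij)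
  also have "\<dots> = (\<Sum>p\<in>{1..N} - {i}. act w (Z i * div_diff i p f))"
    by (rule sum.cong) (auto simp: div_diff_act b act_mult act_Z)
  finally show ?thesis
    by (simp add: dunkl_def partial_deriv_act b act_mult act_Z)
qed

text \<open>In the twisted Leibniz rule only the summand p = k contributes a correction.\<close>

lemma dunkl_Z:
  assumes "k \<noteq> i" "k \<in> {1..N}"
  shows "dunkl \<alpha> N i (Z k * f) = Z k * dunkl \<alpha> N i f - Z i * act (transpose i k) f"
proof -
  have "(\<Sum>p\<in>{1..N} - {i}. Z i * div_diff i p (Z k * f))
      = (\<Sum>p\<in>{1..N} - {i}. Z k * (Z i * div_diff i p f) - (if p = k then Z i * act (transpose i k) f else 0))"
    using assms by (intro sum.cong) (auto simp: div_diff_Z right_diff_distrib distrib_left mult.left_commute[of "Z i" "Z k"])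
  also have "\<dots> = Z k * (\<Sum>p\<in>{1..N} - {i}. Z i * div_diff i p f) - Z i * act (transpose i k) f"
    using assms by (simp add: sum_subtractf sum_distrib_left)
  finally have S: "(\<Sum>p\<in>{1..N} - {i}. Z i * div_diff i p (Z k * f)) = \<dots>" .
  show ?thesis
    unfolding dunkl_def S partial_deriv_Z using assms by (simp add: algebra_simps)
qed

text \<open>Here every p contributes a reflection, and the derivative contributes the
  \<alpha>.\<close>

lemma dunkl_Z_same:
  "dunkl \<alpha> N i (Z i * f) = Z i * dunkl \<alpha> N i f + Const \<alpha> * (Z i * f)
     + Z i * (\<Sum>p\<in>{1..N} - {i}. act (transpose i p) f)"
proof -
  have "(\<Sum>p\<in>{1..N} - {i}. Z i * div_diff i p (Z i * f))
      = (\<Sum>p\<in>{1..N} - {i}. Z i * (Z i * div_diff i p f) + Z i * act (transpose i p) f)"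
    by (intro sum.cong) (auto simp: div_diff_Z distrib_left)
  then have S: "(\<Sum>p\<in>{1..N} - {i}. Z i * div_diff i p (Z i * f))
      = Z i * (\<Sum>p\<in>{1..N} - {i}. Z i * div_diff i p f) + Z i * (\<Sum>p\<in>{1..N} - {i}. act (transpose i p) f)"
    by (simp only: sum.distrib sum_distrib_left)
  show ?thesis
    unfolding dunkl_def S partial_deriv_Z by (simp add: algebra_simps)
qed

text \<open>The extra f is the reflection p = k + 1 in xi_k: it meets the same transposition and
  cancels to the identity. All other terms are carried over by conjugation.\<close>

lemma cherednik_swap:
  assumes k: "1 \<le> k" "k < N"
  shows "cherednik \<alpha> N k (act (transpose k (Suc k)) f) =
    act (transpose k (Suc k)) (cherednik \<alpha> N (Suc k) f) + f"
proof -
  let ?s = "transpose k (Suc k)"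
  have s: "?s permutes {1..N}" using k by (intro permutes_swap_id) auto
  have 1: "dunkl \<alpha> N k (act ?s f) = act ?s (dunkl \<alpha> N (Suc k) f)"
    using dunkl_act[OF s, of \<alpha> "Suc k" f] by simp
  have "{k<..N} = insert (Suc k) {Suc k<..N}" using k by auto
  then have "(\<Sum>p\<in>{k<..N}. act (transpose k p) (act ?s f))
      = f + (\<Sum>p\<in>{Suc k<..N}. act (transpose k p) (act ?s f))" by simp
  also have "(\<Sum>p\<in>{Suc k<..N}. act (transpose k p) (act ?s f))
      = (\<Sum>p\<in>{Suc k<..N}. act ?s (act (transpose (Suc k) p) f))"
    by (rule sum.cong[OF refl], subst act_transpose_conj) auto
  finally have S: "(\<Sum>p\<in>{k<..N}. act (transpose k p) (act ?s f)) =
    f + (\<Sum>p\<in>{Suc k<..N}. act ?s (act (transpose (Suc k) p) f))" .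
  show ?thesis using k by (simp add: cherednik_eq 1 S)
qed

lemma cherednik_swap':
  assumes k: "1 \<le> k" "k < N"
  shows "cherednik \<alpha> N (Suc k) (act (transpose k (Suc k)) f) =
    act (transpose k (Suc k)) (cherednik \<alpha> N k f) - f"
proof -
  let ?s = "transpose k (Suc k)"
  have "cherednik \<alpha> N k f = act ?s (cherednik \<alpha> N (Suc k) (act ?s f)) + act ?s f"
    using cherednik_swap[OF k, of \<alpha> "act ?s f"] by simp
  then have "act ?s (cherednik \<alpha> N k f) = cherednik \<alpha> N (Suc k) (act ?s f) + f" by simp
  then show ?thesis by simp
qed

text \<open>Both k and k + 1 lie on the same side of i, so s_k only permutes the reflections in
  xi_i.\<close>

lemma cherednik_swap_other:
  assumes k: "1 \<le> k" "k < N" and i: "i \<in> {1..N}" "i \<noteq> k" "i \<noteq> Suc k"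
  shows "cherednik \<alpha> N i (act (transpose k (Suc k)) f) =
    act (transpose k (Suc k)) (cherednik \<alpha> N i f)"
proof -
  let ?s = "transpose k (Suc k)"
  have s: "?s permutes {1..N}" using k by (intro permutes_swap_id) auto
  have 1: "dunkl \<alpha> N i (act ?s f) = act ?s (dunkl \<alpha> N i f)"
    using dunkl_act[OF s, of \<alpha> i f] i by simp
  have "bij_betw ?s {i<..N} {i<..N}"
    using k i by (intro bij_betw_byWitness[of _ ?s]) (auto simp: transpose_def)
  then have "(\<Sum>p\<in>{i<..N}. act (transpose i p) (act ?s f)) = (\<Sum>p\<in>{i<..N}. act (transpose i (?s p)) (act ?s f))"
    by (rule sum.reindex_bij_betw[symmetric])
  also have "\<dots> = (\<Sum>p\<in>{i<..N}. act ?s (act (transpose i p) f))"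
    using i by (intro sum.cong[OF refl], subst act_transpose_conj) auto
  finally show ?thesis using i by (simp add: cherednik_eq 1)
qed

text \<open>Knop and Sahi's affine intertwiner \<open>\<Phi> f = z\<^sub>N f(z\<^sub>N, z\<^sub>1, \<dots>, z\<^bsub>N-1\<^esub>)\<close>.\<close>

definition rot :: "nat \<Rightarrow> nat \<Rightarrow> nat" where
  "rot N i = (if i = 1 then N else if i \<in> {1..N} then i - 1 else i)"

lemma rot_permutes: "1 \<le> N \<Longrightarrow> rot N permutes {1..N}"
  by (rule bij_imp_permutes, rule bij_betw_byWitness[of _ "\<lambda>i. if i = N then 1 else Suc i"])
    (auto simp: rot_def)

definition Phi :: "nat \<Rightarrow> mpol \<Rightarrow> mpol" where
  "Phi N f = Z N * act (rot N) f"

text \<open>Moving z_N past \<open>dunkl\<close> costs a term with the transposition of i and N. It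
  cancels against the reflection p = N, whose transposition turns z_N into z_i; the remaining
  reflections are rotated ones.\<close>

lemma cherednik_Phi:
  assumes i: "1 \<le> i" "i < N"
  shows "cherednik \<alpha> N i (Phi N f) = Phi N (cherednik \<alpha> N (Suc i) f)"
proof -
  have r: "rot N permutes {1..N}" using i by (intro rot_permutes) auto
  note b = permutes_bij[OF r]
  let ?g = "act (rot N) f"
  have ri: "rot N (Suc i) = i" using i by (simp add: rot_def)
  have D: "dunkl \<alpha> N i (Phi N f) = Z N * act (rot N) (dunkl \<alpha> N (Suc i) f) - Z i * act (transpose i N) ?g"
    using dunkl_act[OF r, of \<alpha> "Suc i" f] i by (simp add: Phi_def dunkl_Z ri)
  have "{i<..N} = insert N {i<..<N}" using i by auto
  then have "(\<Sum>p\<in>{i<..N}. act (transpose i p) (Z N * ?g))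
      = Z i * act (transpose i N) ?g + (\<Sum>p\<in>{i<..<N}. Z N * act (transpose i p) ?g)"
    using i by (simp add: act_mult act_Z)
  also have "(\<Sum>p\<in>{i<..<N}. Z N * act (transpose i p) ?g) = (\<Sum>p\<in>{Suc i<..N}. Z N * act (transpose i (rot N p)) ?g)"
    by (rule sum.reindex_bij_betw[symmetric], rule bij_betw_byWitness[of _ Suc]) (auto simp: rot_def)
  also have "\<dots> = Z N * act (rot N) (\<Sum>p\<in>{Suc i<..N}. act (transpose (Suc i) p) f)"
    using ri by (simp add: sum_distrib_left act_transpose_conj[OF b, of "Suc i"])
  finally show ?thesis
    using i by (simp add: cherednik_eq D[unfolded Phi_def] Phi_def distrib_left mult.left_commute[of "Z N" "Const _"])
qed

text \<open>The operator xi_N has no reflections of its own; those produced by moving z_N past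
  \<open>dunkl\<close> are the rotated reflections of xi_1, and \<alpha> comes along with
  them.\<close>

lemma cherednik_Phi_last:
  assumes "1 \<le> N"
  shows "cherednik \<alpha> N N (Phi N f) = Phi N (cherednik \<alpha> N 1 f + Const \<alpha> * f)"
proof -
  note r = rot_permutes[OF assms]
  note b = permutes_bij[OF r]
  let ?g = "act (rot N) f"
  have r1: "rot N 1 = N" by (simp add: rot_def)
  have "(\<Sum>p\<in>{1..N} - {N}. act (transpose N p) ?g) = (\<Sum>p\<in>{1<..N}. act (transpose N (rot N p)) ?g)"
    by (rule sum.reindex_bij_betw[symmetric], rule bij_betw_byWitness[of _ Suc]) (auto simp: rot_def)
  also have "\<dots> = act (rot N) (\<Sum>p\<in>{1<..N}. act (transpose 1 p) f)"
    using r1 by (simp add: act_transpose_conj[OF b, of "Suc 0"])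
  finally show ?thesis
    using assms dunkl_act[OF r, of \<alpha> 1 f] 
    by (simp add: cherednik_eq r1[simplified] Phi_def dunkl_Z_same distrib_left mult.left_commute[of "Z N" "Const _"]
        add.assoc add.left_commute add.commute)
qed

section \<open>The triangularity order\<close>

text \<open>Subtraction is truncated, so this sums positive parts. At equal weight, comparing these
  sums for all t is equivalent to dominance of the sorted compositions, without any sorting.\<close>

definition excess :: "nat \<Rightarrow> comp \<Rightarrow> nat \<Rightarrow> nat" where
  "excess N \<mu> t = (\<Sum>j=1..N. look \<mu> j - t)"

text \<open>The counting function of the tableau criterion for the Bruhat order on an orbit.\<close>

definition cnt :: "comp \<Rightarrow> nat \<Rightarrow> nat \<Rightarrow> nat" where
  "cnt \<mu> p t = (\<Sum>j=1..p. of_bool (t \<le> look \<mu> j))"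

text \<open>Invariant under permutations of the positions; compositions with equal multisets lie in
  one orbit of the symmetric group.\<close>

definition entries :: "nat \<Rightarrow> comp \<Rightarrow> nat multiset" where
  "entries N \<mu> = image_mset (look \<mu>) (mset_set {1..N})"

text \<open>Stronger than \<open>\<prec>\<close>: the first alternative is strict dominance of the sorted compositions, the second is
  the Bruhat order on the orbit of \<open>\<eta>\<close>, which implies dominance.\<close>

definition below :: "nat \<Rightarrow> comp \<Rightarrow> comp \<Rightarrow> bool" where
  "below N \<nu> \<eta> \<longleftrightarrow> composition N \<nu> \<and> composition N \<eta> \<and> weight N \<nu> = weight N \<eta> \<and>
     ((\<forall>t. excess N \<nu> t \<le> excess N \<eta> t) \<and> (\<exists>t. excess N \<nu> t < excess N \<eta> t) \<or>
      entries N \<nu> = entries N \<eta> \<and> \<nu> \<noteq> \<eta> \<and> (\<forall>p\<le>N. \<forall>t. cnt \<nu> p t \<le> cnt \<eta> p t))"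

lemma composition_iff: "composition N \<mu> \<longleftrightarrow> (\<forall>j. j \<notin> {1..N} \<longrightarrow> look \<mu> j = 0)"
  by (auto simp: composition_def in_keys_iff)

lemma compositionD: "composition N \<mu> \<Longrightarrow> j \<notin> {1..N} \<Longrightarrow> look \<mu> j = 0"
  by (simp add: composition_iff)

lemma composition_eqI:
  assumes "composition N \<mu>" "composition N \<nu>" "\<And>j. j \<in> {1..N} \<Longrightarrow> look \<mu> j = look \<nu> j"
  shows "\<mu> = \<nu>"
  using assms by (intro poly_mapping_eqI) (metis compositionD)

lemma composition_perm: "w permutes {1..N} \<Longrightarrow> composition N \<mu> \<Longrightarrow> composition N (perm_comp w \<mu>)"
  unfolding composition_iff
  by (metis look_perm_comp permutes_bij permutes_inv permutes_in_image)

lemma composition_exps: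
  "composition N \<mu> \<Longrightarrow> i \<in> {1..N} \<Longrightarrow> p \<in> {1..N} \<Longrightarrow> composition N (exps i p \<mu> x y)"
  by (auto simp: composition_iff look_exps)

lemma excess_entries: "excess N \<mu> t = (\<Sum>x\<in>#entries N \<mu>. x - t)"
  by (simp add: excess_def entries_def sum_unfold_sum_mset image_mset.compositionality o_def)

lemma weight_excess: "weight N \<mu> = excess N \<mu> 0"
  by (simp add: weight_def excess_def)

lemma entries_perm:
  assumes w: "w permutes {1..N}"
  shows "entries N (perm_comp w \<mu>) = entries N \<mu>"
proof -
  have "look (perm_comp w \<mu>) = look \<mu> \<circ> inv w"
    by (simp add: fun_eq_iff look_perm_comp permutes_bij[OF w])
  then have "entries N (perm_comp w \<mu>) = image_mset (look \<mu>) (image_mset (inv w) (mset_set {1..N}))"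
    by (simp add: entries_def image_mset.compositionality)
  also have "image_mset (inv w) (mset_set {1..N}) = mset_set {1..N}"
    using permutes_inv[OF w] by (simp add: image_mset_mset_set permutes_inj_on permutes_image)
  finally show ?thesis by (simp add: entries_def)
qed

lemma cnt_Suc: "cnt \<mu> (Suc p) t = cnt \<mu> p t + of_bool (t \<le> look \<mu> (Suc p))"
  by (simp add: cnt_def)

lemma cnt_eqI:
  assumes "composition N \<mu>" "composition N \<nu>" "\<And>p t. p \<le> N \<Longrightarrow> cnt \<mu> p t = cnt \<nu> p t"
  shows "\<mu> = \<nu>"
proof (rule composition_eqI[OF assms(1,2)])
  fix j assume "j \<in> {1..N}"
  then obtain p where j: "j = Suc p" "Suc p \<le> N" by (cases j) auto
  have "t \<le> look \<mu> j \<longleftrightarrow> t \<le> look \<nu> j" for t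
    using assms(3)[of p t] assms(3)[of j t] j by (auto simp: cnt_Suc of_bool_def split: if_splits)
  then show "look \<mu> j = look \<nu> j" by (meson order.antisym order.refl)
qed

lemma below_irrefl: "\<not> below N \<mu> \<mu>"
  by (simp add: below_def)

lemma below_trans: "below N \<mu> \<nu> \<Longrightarrow> below N \<nu> \<kappa> \<Longrightarrow> below N \<mu> \<kappa>"
proof -
  assume *: "below N \<mu> \<nu>" "below N \<nu> \<kappa>"
  \<comment> \<open>The excess depends on the orbit only, so a Bruhat step before or after a
    dominance step does not disturb the latter.\<close>
  have E: "excess N a t = excess N b t" if "entries N a = entries N b" for a b t
    using that by (simp add: excess_entries)
  consider "\<forall>t. excess N \<mu> t \<le> excess N \<nu> t" "\<exists>t. excess N \<mu> t < excess N \<nu> t"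
    | "entries N \<mu> = entries N \<nu>" "\<forall>t. excess N \<nu> t \<le> excess N \<kappa> t" "\<exists>t. excess N \<nu> t < excess N \<kappa> t"
    | "entries N \<mu> = entries N \<nu>" "entries N \<nu> = entries N \<kappa>" "\<mu> \<noteq> \<nu>"
      "\<forall>p\<le>N. \<forall>t. cnt \<mu> p t \<le> cnt \<nu> p t" "\<forall>p\<le>N. \<forall>t. cnt \<nu> p t \<le> cnt \<kappa> p t"
    using * unfolding below_def by blast
  then show ?thesis
  proof cases
    case 1
    have "\<forall>t. excess N \<nu> t \<le> excess N \<kappa> t" using *(2) E[of \<nu> \<kappa>] by (auto simp: below_def)
    with 1 * show ?thesis unfolding below_def by (metis le_trans less_le_trans)
  next
    case 2
    with * E[OF 2(1)] show ?thesis unfolding below_def by simp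
  next
    case 3
    have "\<mu> \<noteq> \<kappa>"
    proof
      assume "\<mu> = \<kappa>"
      then have "\<mu> = \<nu>" using 3 * by (intro cnt_eqI[of N]) (auto simp: below_def intro: antisym)
      with 3 show False by simp
    qed
    with 3 * show ?thesis unfolding below_def by (metis le_trans)
  qed
qed

abbreviation below_eq :: "nat \<Rightarrow> comp \<Rightarrow> comp \<Rightarrow> bool" where
  "below_eq N \<mu> \<nu> \<equiv> \<mu> = \<nu> \<or> below N \<mu> \<nu>"

lemma below_antisym: "below_eq N \<mu> \<nu> \<Longrightarrow> below_eq N \<nu> \<mu> \<Longrightarrow> \<mu> = \<nu>"
  using below_trans below_irrefl by blast

section \<open>Comparison with the order of the definition\<close>

definition desc_entries :: "nat \<Rightarrow> comp \<Rightarrow> nat list" where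
  "desc_entries N \<mu> = rev (sort (map (look \<mu>) [1..<Suc N]))"

lemma mset_desc_entries: "mset (desc_entries N \<mu>) = entries N \<mu>"
  by (simp add: desc_entries_def entries_def del: upt_Suc)
    (metis atLeastLessThanSuc_atLeastAtMost mset_upt)

lemma sorted_comp_desc: "sorted_comp N \<mu> = Poly_Mapping.nth (0 # desc_entries N \<mu>)"
  by (simp only: sorted_comp_def desc_entries_def)

lemma length_desc_entries [simp]: "length (desc_entries N \<mu>) = N"
  by (simp add: desc_entries_def del: upt_Suc)

lemma sum_sorted_comp: "p \<le> N \<Longrightarrow> (\<Sum>j=1..p. look (sorted_comp N \<mu>) j) = sum_list (take p (desc_entries N \<mu>))"
proof -
  assume p: "p \<le> N"
  have "(\<Sum>j=1..p. look (sorted_comp N \<mu>) j) = (\<Sum>j\<in>{0..<p}. look (sorted_comp N \<mu>) (Suc j))"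
    by (simp add: sum.atLeast_Suc_atMost_Suc_shift[symmetric] atLeastLessThanSuc_atLeastAtMost
        flip: sum.shift_bounds_Suc_ivl)
  also have "\<dots> = (\<Sum>j\<in>{0..<p}. desc_entries N \<mu> ! j)"
    using p by (intro sum.cong) (auto simp: sorted_comp_desc nth.rep_eq nth_default_def simp del: upt_Suc)
  also have "\<dots> = sum_list (take p (desc_entries N \<mu>))"
    using p by (simp add: sum_list_sum_nth)
  finally show ?thesis .
qed

lemma excess_desc: "excess N \<mu> t = (\<Sum>x\<leftarrow>desc_entries N \<mu>. x - t)"
  by (metis excess_entries mset_desc_entries mset_map sum_mset_sum_list)

lemma sorted_comp_eqI: "entries N \<mu> = entries N \<nu> \<Longrightarrow> sorted_comp N \<mu> = sorted_comp N \<nu>"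
proof -
  assume "entries N \<mu> = entries N \<nu>"
  then have "mset (sort (map (look \<mu>) [1..<Suc N])) = mset (sort (map (look \<nu>) [1..<Suc N]))"
    by (metis mset_desc_entries desc_entries_def mset_rev)
  then have "sort (map (look \<mu>) [1..<Suc N]) = sort (map (look \<nu>) [1..<Suc N])"
    by (metis mset_sort properties_for_sort sorted_sort)
  then show ?thesis by (simp add: sorted_comp_def del: upt_Suc)
qed

lemma desc_entries_sorted_comp: "desc_entries N \<mu> = map (look (sorted_comp N \<mu>)) [1..<Suc N]"
  by (rule nth_equalityI)
    (auto simp: sorted_comp_desc nth.rep_eq nth_default_def simp del: upt_Suc)

text \<open>The sum of the \<open>p\<close> largest entries is \<open>p t\<close> plus the excess over \<open>t\<close>, where \<open>t\<close> is the \<open>p\<close>-th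
  largest entry; for any other \<open>t\<close> it is at most this quantity.\<close>

lemma sum_take_mono:
  fixes L M :: "nat list"
  assumes len: "length L = length M" "p \<le> length M"
    and M: "sorted (rev M)"
    and le: "\<And>t. (\<Sum>x\<leftarrow>L. x - t) \<le> (\<Sum>x\<leftarrow>M. x - t)"
  shows "sum_list (take p L) \<le> sum_list (take p M)"
proof (cases "p = 0")
  case False
  define t where "t = M ! (p - 1)"
  have M': "M ! j \<le> M ! i" if "i \<le> j" "j < length M" for i j
    using sorted_rev_nth_mono[OF M that] .
  have hd: "t \<le> x" if x: "x \<in> set (take p M)" for x
    using x M' len False by (auto simp: in_set_conv_nth t_def)
  have tl: "x \<le> t" if x: "x \<in> set (drop p M)" for x
    using x M' len False by (auto simp: in_set_conv_nth t_def)
  have "sum_list (take p L) \<le> (\<Sum>x\<leftarrow>take p L. t + (x - t))"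
    by (rule sum_list_mono[of _ "\<lambda>x. x", simplified]) auto
  also have "\<dots> = p * t + (\<Sum>x\<leftarrow>take p L. x - t)"
    using len by (simp add: sum_list_addf sum_list_triv)
  also have "(\<Sum>x\<leftarrow>take p L. x - t) \<le> (\<Sum>x\<leftarrow>L. x - t)"
    by (metis append_take_drop_id le_add1 map_append sum_list_append)
  also note le
  also have "(\<Sum>x\<leftarrow>M. x - t) = (\<Sum>x\<leftarrow>take p M. x - t) + (\<Sum>x\<leftarrow>drop p M. x - t)"
    by (metis append_take_drop_id map_append sum_list_append)
  also have "(\<Sum>x\<leftarrow>drop p M. x - t) = 0" using tl by (simp add: sum_list_eq_0_iff)
  also have "p * t + ((\<Sum>x\<leftarrow>take p M. x - t) + 0) = (\<Sum>x\<leftarrow>take p M. t + (x - t))"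
    using len by (simp add: sum_list_addf sum_list_triv)
  also have "\<dots> = (\<Sum>x\<leftarrow>take p M. x)"
    using hd by (intro arg_cong[of _ _ sum_list] map_cong) auto
  finally show ?thesis by simp
qed simp

text \<open>An entry equals the number of positive thresholds it reaches. Summing over thresholds
  first converts inequalities between counts into dominance.\<close>

lemma sum_look_cnt:
  assumes "\<And>j. look \<mu> j \<le> M"
  shows "(\<Sum>j=1..p. look \<mu> j) = (\<Sum>t=1..M. cnt \<mu> p t)"
proof -
  have "look \<mu> j = (\<Sum>t=1..M. of_bool (t \<le> look \<mu> j))" for j
  proof -
    have "{t \<in> {1..M}. t \<le> look \<mu> j} = {1..look \<mu> j}" using assms[of j] by auto
    then show ?thesis by (simp add: of_bool_def sum.If_cases Int_def)
  qed
  then have "(\<Sum>j=1..p. look \<mu> j) = (\<Sum>j=1..p. \<Sum>t=1..M. of_bool (t \<le> look \<mu> j))"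
    by (intro sum.cong) auto
  also have "\<dots> = (\<Sum>t=1..M. cnt \<mu> p t)" unfolding cnt_def by (rule sum.swap)
  finally show ?thesis .
qed

lemma below_prec: "below N \<nu> \<eta> \<Longrightarrow> prec N \<nu> \<eta>"
proof -
  assume b: "below N \<nu> \<eta>"
  have ne: "\<nu> \<noteq> \<eta>" using b below_irrefl by blast
  show ?thesis
  proof (cases "entries N \<nu> = entries N \<eta>")
    case True
    \<comment> \<open>Equal entries give equal excess, which rules out the first alternative of
      \<open>below\<close>.\<close>
    then have cnt: "\<forall>p\<le>N. \<forall>t. cnt \<nu> p t \<le> cnt \<eta> p t" using b by (auto simp: below_def excess_entries)
    obtain M where M: "look \<nu> j \<le> M" "look \<eta> j \<le> M" for j
    proof
      let ?M = "\<Sum>j=1..N. look \<nu> j + look \<eta> j"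
      have c: "composition N \<nu>" "composition N \<eta>" using b by (auto simp: below_def)
      fix j show "look \<nu> j \<le> ?M" "look \<eta> j \<le> ?M"
        using c[THEN compositionD, of j] member_le_sum[of j "{1..N}" "\<lambda>j. look \<nu> j + look \<eta> j"]
        by (cases "j \<in> {1..N}"; simp)+
    qed
    have "dom_less N \<nu> \<eta>"
      unfolding dom_less_def sum_look_cnt[of \<nu>, OF M(1)] sum_look_cnt[of \<eta>, OF M(2)]
      using ne cnt b by (auto simp: below_def intro: sum_mono)
    then show ?thesis using b ne sorted_comp_eqI[OF True] by (simp add: prec_def below_def)
  next
    case False
    then have le: "\<forall>t. excess N \<nu> t \<le> excess N \<eta> t" and lt: "\<exists>t. excess N \<nu> t < excess N \<eta> t"
      using b by (auto simp: below_def)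
    have "sorted_comp N \<nu> \<noteq> sorted_comp N \<eta>"
      using lt by (auto simp: excess_desc desc_entries_sorted_comp)
    moreover have "sum_list (take p (desc_entries N \<nu>)) \<le> sum_list (take p (desc_entries N \<eta>))" if "p \<le> N" for p
      using that le by (intro sum_take_mono) (auto simp: excess_desc, auto simp: desc_entries_def simp del: upt_Suc)
    moreover have "weight N (sorted_comp N \<mu>) = weight N \<mu>" for \<mu>
    proof -
      have "weight N (sorted_comp N \<mu>) = sum_list (desc_entries N \<mu>)"
        by (simp only: weight_def sum_sorted_comp[OF order.refl]) simp
      then show ?thesis by (simp add: weight_excess[of N \<mu>] excess_desc)
    qed
    ultimately have "dom_less N (sorted_comp N \<nu>) (sorted_comp N \<eta>)"
      using b by (auto simp: dom_less_def sum_sorted_comp[simplified] below_def)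
    then show ?thesis using b ne by (simp add: prec_def below_def)
  qed
qed

text \<open>The positive part is a convex function, so moving two entries strictly closer together
  at a fixed sum cannot increase any excess.\<close>

lemma below_spread:
  assumes c: "composition N \<mu>" and ip: "i \<in> {1..N}" "p \<in> {1..N}" "i \<noteq> p"
    and xy: "x + y = look \<mu> i + look \<mu> p" "min (look \<mu> i) (look \<mu> p) < x" "min (look \<mu> i) (look \<mu> p) < y"
  shows "below N (exps i p \<mu> x y) \<mu>"
proof -
  let ?\<nu> = "exps i p \<mu> x y" and ?R = "{1..N} - {i, p}"
  have I: "{1..N} = insert i (insert p ?R)" using ip by auto
  have split: "excess N \<kappa> t = (look \<kappa> i - t) + (look \<kappa> p - t) + (\<Sum>j\<in>?R. look \<kappa> j - t)" for \<kappa> t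
    unfolding excess_def by (subst I) (use ip in simp)
  have R: "(\<Sum>j\<in>?R. look ?\<nu> j - t) = (\<Sum>j\<in>?R. look \<mu> j - t)" for t
    by (intro sum.cong) (auto simp: look_exps)
  have le: "(x - t) + (y - t) \<le> (look \<mu> i - t) + (look \<mu> p - t)" for t
    using xy by linarith
  have "excess N ?\<nu> t \<le> excess N \<mu> t" for t
    using le[of t] ip unfolding split[of ?\<nu>] split[of \<mu>] R by (simp add: look_exps)
  \<comment> \<open>At this threshold the new pair contributes nothing, while the larger old entry
    still exceeds it.\<close>
  moreover have "excess N ?\<nu> (max x y) < excess N \<mu> (max x y)"
    using xy ip unfolding split[of ?\<nu>] split[of \<mu>] R by (simp add: look_exps max_def min_def split: if_splits)
  moreover have "weight N ?\<nu> = weight N \<mu>"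
    using xy ip unfolding weight_excess split[of ?\<nu>] split[of \<mu>] R by (simp add: look_exps)
  ultimately show ?thesis using composition_exps[OF c ip(1,2)] c by (auto simp: below_def)
qed

text \<open>Only prefixes that contain j but not k notice the swap. The additive form avoids
  truncated differences.\<close>

lemma cnt_swap:
  assumes jk: "1 \<le> j" "j < k"
  shows "cnt (perm_comp (transpose j k) \<mu>) p t + of_bool (j \<le> p \<and> p < k \<and> t \<le> look \<mu> j) =
    cnt \<mu> p t + of_bool (j \<le> p \<and> p < k \<and> t \<le> look \<mu> k)"
proof -
  let ?s = "transpose j k"
  have L: "cnt (perm_comp ?s \<mu>) p t = (\<Sum>i=1..p. of_bool (t \<le> look \<mu> (?s i)))"
    by (simp add: cnt_def look_perm_comp)
  consider "p < j" | "k \<le> p" | "j \<le> p" "p < k" by linarith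
  then show ?thesis
  proof cases
    case 1
    then have "cnt (perm_comp ?s \<mu>) p t = cnt \<mu> p t"
      unfolding L unfolding cnt_def using jk by (intro sum.cong) auto
    with 1 show ?thesis by simp
  next
    case 2
    then have "?s permutes {1..p}" using jk by (intro permutes_swap_id) auto
    then have "bij_betw ?s {1..p} {1..p}" by (rule permutes_imp_bij)
    then have "cnt (perm_comp ?s \<mu>) p t = cnt \<mu> p t"
      unfolding L unfolding cnt_def by (rule sum.reindex_bij_betw)
    with 2 show ?thesis by simp
  next
    case 3
    then have "{1..p} = insert j ({1..p} - {j})" using jk by auto
    then have split: "(\<Sum>i=1..p. f i) = f j + (\<Sum>i\<in>{1..p} - {j}. f i)" for f :: "nat \<Rightarrow> nat"
      by (metis finite_atLeastAtMost finite_Diff insert_iff sum.insert_remove Diff_insert_absorb sum.remove)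
    have R: "(\<Sum>i\<in>{1..p} - {j}. of_bool (t \<le> look \<mu> (?s i))) = (\<Sum>i\<in>{1..p} - {j}. of_bool (t \<le> look \<mu> i) :: nat)"
      using 3 by (intro sum.cong) auto
    have "cnt (perm_comp ?s \<mu>) p t = of_bool (t \<le> look \<mu> k) + (\<Sum>i\<in>{1..p} - {j}. of_bool (t \<le> look \<mu> i))"
      unfolding L split R by simp
    moreover have "cnt \<mu> p t = of_bool (t \<le> look \<mu> j) + (\<Sum>i\<in>{1..p} - {j}. of_bool (t \<le> look \<mu> i))"
      unfolding cnt_def split by simp
    ultimately show ?thesis using 3 by simp
  qed
qed

lemma below_swap:
  assumes c: "composition N \<mu>" and jk: "1 \<le> j" "j < k" "k \<le> N" and gt: "look \<mu> k < look \<mu> j"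
  shows "below N (perm_comp (transpose j k) \<mu>) \<mu>"
proof -
  let ?s = "transpose j k"
  have s: "?s permutes {1..N}" using jk by (intro permutes_swap_id) auto
  have "look (perm_comp ?s \<mu>) j \<noteq> look \<mu> j" using gt by (simp add: look_perm_comp)
  then have "perm_comp ?s \<mu> \<noteq> \<mu>" by metis
  moreover have "cnt (perm_comp ?s \<mu>) p t \<le> cnt \<mu> p t" for p t
    using cnt_swap[OF jk(1,2), of \<mu> p t] gt by (auto simp: of_bool_def split: if_splits)
  ultimately show ?thesis
    using c composition_perm[OF s c] entries_perm[OF s] by (simp add: below_def weight_excess excess_entries)
qed

text \<open>This fails for the dominance order: \<open>(0,4,2,2)\<close> is dominated by \<open>(2,2,4,0)\<close>, but
  \<open>(4,0,2,2)\<close> is not.\<close>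

lemma below_eq_swap_dominant:
  assumes \<eta>: "look \<eta> (Suc k) \<le> look \<eta> k" and k: "1 \<le> k" "k < N" and \<nu>: "below_eq N \<nu> \<eta>"
    and c: "composition N \<eta>"
  shows "below_eq N (perm_comp (transpose k (Suc k)) \<nu>) \<eta>"
proof -
  let ?s = "transpose k (Suc k)"
  have s: "?s permutes {1..N}" using k by (intro permutes_swap_id) auto
  have c': "composition N \<nu>" using \<nu> c by (auto simp: below_def)
  note E = entries_perm[OF s, of \<nu>] and c'' = composition_perm[OF s c']
  show ?thesis
  proof (cases "entries N \<nu> = entries N \<eta>")
    case False
    then show ?thesis
      using \<nu> E c'' by (auto simp: below_def weight_excess excess_entries)
  next
    case True
    then have le: "\<forall>p\<le>N. \<forall>t. cnt \<nu> p t \<le> cnt \<eta> p t" using \<nu> by (auto simp: below_def excess_entries)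
    obtain q where q: "k = Suc q" using k by (cases k) auto
    have "cnt (perm_comp ?s \<nu>) p t \<le> cnt \<eta> p t" if p: "p \<le> N" for p t
    proof (cases "p = k")
      case False
      then show ?thesis using le p cnt_swap[of k "Suc k" \<nu> p t] k
        by (cases p k rule: linorder_cases) auto
    next
      case True
      have S: "cnt (perm_comp ?s \<nu>) k t = cnt \<nu> q t + of_bool (t \<le> look \<nu> (Suc k))"
        using cnt_swap[of k "Suc k" \<nu> q t] k q by (simp add: cnt_Suc look_perm_comp)
      have "cnt \<nu> q t \<le> cnt \<eta> q t" "cnt \<nu> (Suc k) t \<le> cnt \<eta> (Suc k) t" using le k q by auto
      \<comment> \<open>If t is at most \<eta>_k, the prefix of length k gains one over the prefix q
        of \<eta>, which covers any gain of the swapped \<nu>. Otherwise \<eta>_(k+1) misses t as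
        well, and the comparison at k + 1 suffices.\<close>
      then show ?thesis unfolding True S using \<eta> q
        by (cases "t \<le> look \<eta> k") (auto simp: cnt_Suc of_bool_def split: if_splits)
    qed
    then show ?thesis
      using E True c c'' by (auto simp: below_def weight_excess excess_entries)
  qed
qed

text \<open>The mirror image within one orbit. It makes a composition without descents along the
  generators the smallest one of its orbit.\<close>

lemma below_eq_swap_antidominant:
  assumes \<eta>: "look \<eta> k \<le> look \<eta> (Suc k)" and k: "1 \<le> k" "k < N" and \<nu>: "below_eq N \<eta> \<nu>"
    and E: "entries N \<nu> = entries N \<eta>" and c: "composition N \<eta>"
  shows "below_eq N \<eta> (perm_comp (transpose k (Suc k)) \<nu>)"
proof -
  let ?s = "transpose k (Suc k)"
  have s: "?s permutes {1..N}" using k by (intro permutes_swap_id) auto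
  have c': "composition N \<nu>" using \<nu> c by (auto simp: below_def)
  note E' = entries_perm[OF s, of \<nu>] and c'' = composition_perm[OF s c']
  have le: "\<forall>p\<le>N. \<forall>t. cnt \<eta> p t \<le> cnt \<nu> p t" using \<nu> E by (auto simp: below_def excess_entries)
  obtain q where q: "k = Suc q" using k by (cases k) auto
  have "cnt \<eta> p t \<le> cnt (perm_comp ?s \<nu>) p t" if p: "p \<le> N" for p t
  proof (cases "p = k")
    case False
    then show ?thesis using le p cnt_swap[of k "Suc k" \<nu> p t] k
        by (cases p k rule: linorder_cases) auto
  next
    case True
    have S: "cnt (perm_comp ?s \<nu>) k t = cnt \<nu> q t + of_bool (t \<le> look \<nu> (Suc k))"
      using cnt_swap[of k "Suc k" \<nu> q t] k q by (simp add: cnt_Suc look_perm_comp)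
    have "cnt \<eta> q t \<le> cnt \<nu> q t" "cnt \<eta> (Suc k) t \<le> cnt \<nu> (Suc k) t" using le k q by auto
    \<comment> \<open>If t is at most \<eta>_k, then \<eta>_(k+1) reaches t too and the comparison
      at k + 1 is used; otherwise the comparison at q.\<close>
    then show ?thesis unfolding True S using \<eta> q
      by (cases "t \<le> look \<eta> k") (auto simp: cnt_Suc of_bool_def split: if_splits)
  qed
  then show ?thesis
    using E E' c c'' by (auto simp: below_def weight_excess excess_entries)
qed

section \<open>Triangularity and nonsymmetric Jack polynomials\<close>

definition lower :: "nat \<Rightarrow> comp \<Rightarrow> mpol set" where
  "lower N \<nu> = {g. \<forall>\<kappa>\<in>supp g. below N \<kappa> \<nu>}"

lemma lower_subspace: "mpol.subspace (lower N \<nu>)"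
  by (rule mpol.subspaceI) (auto simp: lower_def lookup_add in_keys_iff split: if_splits)

lemmas lower_intros = mpol.subspace_0[OF lower_subspace] mpol.subspace_add[OF lower_subspace]
  mpol.subspace_sum[OF lower_subspace] mpol.subspace_neg[OF lower_subspace]

lemma monom_nonzero: "monom \<mu> \<noteq> 0"
  by (metis look_monom lookup_zero zero_neq_one)

lemma lower_monom: "below N \<mu> \<nu> \<Longrightarrow> monom \<mu> \<in> lower N \<nu>"
  by (simp add: lower_def monom_def)

text \<open>The factor z_i shifts the geometric sum so that only one of its extreme monomials
  survives. This is z^\<nu> if the entry at i is the larger one, and otherwise the swapped monomial,
  which is lower because the larger entry moves to the right. All other terms have the two entries
  strictly closer together.\<close>

lemma Z_div_diff_less:
  assumes c: "composition N \<nu>" and p: "1 \<le> p" "p < i" "i \<le> N"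
  shows "Z i * div_diff i p (monom \<nu>) - Const (of_bool (look \<nu> p < look \<nu> i)) * monom \<nu> \<in> lower N \<nu>"
proof -
  have ip: "i \<noteq> p" "i \<in> {1..N}" "p \<in> {1..N}" using p by auto
  let ?a = "look \<nu> i" and ?b = "look \<nu> p"
  consider "?a = ?b" | n where "?a = Suc (?b + n)" | n where "?b = Suc (?a + n)"
    using less_imp_Suc_add by (metis linorder_neqE_nat)
  then show ?thesis
  proof cases
    case 1
    then show ?thesis using div_diff_monom_ge[of i p \<nu>] ip by (simp add: lower_intros)
  next
    case 2
    have "Z i * div_diff i p (monom \<nu>) = (\<Sum>m<Suc n. monom (exps i p \<nu> (Suc (?b + m)) (?a - Suc m)))"
      using 2 ip by (simp add: div_diff_monom_ge sum_distrib_left Z_exps1 del: sum.lessThan_Suc)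
    also have "\<dots> = (\<Sum>m<n. monom (exps i p \<nu> (Suc (?b + m)) (?a - Suc m))) + monom \<nu>"
      using 2 exps_self[of i p \<nu>] by simp
    finally show ?thesis
      using 2 c ip by (auto intro!: lower_intros lower_monom below_spread)
  next
    case 3
    have "Z i * div_diff i p (monom \<nu>) = - (\<Sum>m<Suc n. monom (exps i p \<nu> (Suc (?a + m)) (?b - Suc m)))"
      using 3 ip by (simp add: div_diff_monom_le sum_distrib_left Z_exps1 del: sum.lessThan_Suc)
    also have "\<dots> = - ((\<Sum>m<n. monom (exps i p \<nu> (Suc (?a + m)) (?b - Suc m))) + monom (perm_comp (transpose i p) \<nu>))"
      using 3 exps_swap[of i p \<nu>] ip by simp
    finally have eq: "Z i * div_diff i p (monom \<nu>) = \<dots>" .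
    have "monom (perm_comp (transpose i p) \<nu>) \<in> lower N \<nu>"
      using below_swap[OF c, of p i] p 3 by (intro lower_monom) (simp add: transpose_commute)
    then show ?thesis
      unfolding eq using 3 c ip by (auto intro!: lower_intros lower_monom below_spread simp del: minus_add_distrib)
  qed
qed

text \<open>The factor z_p keeps the opposite end of the geometric sum, so z^\<nu> now survives with
  coefficient -1 when the entry at p is the larger one.\<close>

lemma Z_div_diff_greater:
  assumes c: "composition N \<nu>" and p: "1 \<le> i" "i < p" "p \<le> N"
  shows "Z p * div_diff i p (monom \<nu>) + Const (of_bool (look \<nu> i < look \<nu> p)) * monom \<nu> \<in> lower N \<nu>"
proof -
  have ip: "i \<noteq> p" "i \<in> {1..N}" "p \<in> {1..N}" using p by auto
  let ?a = "look \<nu> i" and ?b = "look \<nu> p"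
  consider "?a = ?b" | n where "?a = Suc (?b + n)" | n where "?b = Suc (?a + n)"
    using less_imp_Suc_add by (metis linorder_neqE_nat)
  then show ?thesis
  proof cases
    case 1
    then show ?thesis using div_diff_monom_ge[of i p \<nu>] ip by (simp add: lower_intros)
  next
    case 2
    have "Z p * div_diff i p (monom \<nu>) = (\<Sum>m<Suc n. monom (exps i p \<nu> (?b + m) (Suc (?a - Suc m))))"
      using 2 ip by (simp add: div_diff_monom_ge sum_distrib_left Z_exps2 del: sum.lessThan_Suc)
    also have "\<dots> = monom (perm_comp (transpose i p) \<nu>)
        + (\<Sum>m<n. monom (exps i p \<nu> (?b + Suc m) (Suc (?a - Suc (Suc m)))))"
      using 2 exps_swap[of i p \<nu>] ip by (simp add: sum.lessThan_Suc_shift del: sum.lessThan_Suc)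
    finally have eq: "Z p * div_diff i p (monom \<nu>) = \<dots>" .
    have "monom (perm_comp (transpose i p) \<nu>) \<in> lower N \<nu>"
      using below_swap[OF c, of i p] p 2 by (intro lower_monom) simp
    then show ?thesis
      unfolding eq using 2 c ip by (auto intro!: lower_intros lower_monom below_spread)
  next
    case 3
    have "Z p * div_diff i p (monom \<nu>) = - (\<Sum>m<Suc n. monom (exps i p \<nu> (?a + m) (Suc (?b - Suc m))))"
      using 3 ip by (simp add: div_diff_monom_le sum_distrib_left Z_exps2 del: sum.lessThan_Suc)
    also have "\<dots> = - (monom \<nu> + (\<Sum>m<n. monom (exps i p \<nu> (?a + Suc m) (Suc (?b - Suc (Suc m))))))"
      using 3 exps_self[of i p \<nu>] by (simp add: sum.lessThan_Suc_shift del: sum.lessThan_Suc)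
    finally have eq: "Z p * div_diff i p (monom \<nu>) = \<dots>" .
    have "- (\<Sum>m<n. monom (exps i p \<nu> (?a + Suc m) (Suc (?b - Suc (Suc m))))) \<in> lower N \<nu>"
      using 3 c ip by (intro lower_intros lower_monom below_spread) auto
    then show ?thesis unfolding eq using 3 by simp
  qed
qed

text \<open>Passing to the complement among the positions before i produces exactly the diagonal
  coefficients contributed by the divided differences.\<close>

lemma eta_bar_alt:
  assumes "1 \<le> i"
  shows "eta_bar \<alpha> N \<eta> i = \<alpha> * real (look \<eta> i) + (\<Sum>p\<in>{1..<i}. of_bool (look \<eta> p < look \<eta> i))
    - (\<Sum>p\<in>{i<..N}. of_bool (look \<eta> i < look \<eta> p)) + (1 - real i)"
proof -
  let ?A = "{k\<in>{1..<i}. look \<eta> k \<ge> look \<eta> i}" and ?B = "{k\<in>{1..<i}. look \<eta> k < look \<eta> i}"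
  have S: "(\<Sum>p\<in>A. of_bool (P p)) = real (card {p\<in>A. P p})" if "finite A" for A :: "nat set" and P
    using that by (simp add: of_bool_def sum.If_cases Int_def)
  have "?A \<union> ?B = {1..<i}" by auto
  moreover have "card (?A \<union> ?B) = card ?A + card ?B" by (rule card_Un_disjoint) auto
  ultimately have "card ?A + card ?B + 1 = i" using assms by simp
  then have "real (card ?A) + real (card ?B) + 1 = real i" by linarith
  then show ?thesis unfolding eta_bar_def S[OF finite_atLeastLessThan] S[OF finite_greaterThanAtMost] by linarith
qed

lemma Z_partial_deriv_monom: "Z i * partial_deriv i (monom \<nu>) = Const (real (look \<nu> i)) * monom \<nu>"
proof (cases "look \<nu> i = 0")
  case False
  then have "\<nu> - Poly_Mapping.single i 1 + Poly_Mapping.single i 1 = \<nu>"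
    by (intro poly_mapping_eqI) (auto simp: lookup_minus lookup_add lookup_single when_def)
  then show ?thesis by (simp add: partial_deriv_def mult.left_commute[of "Z i"] Z_monom)
qed (simp add: partial_deriv_def)

lemma cherednik_monom:
  assumes c: "composition N \<nu>" and i: "i \<in> {1..N}"
  shows "cherednik \<alpha> N i (monom \<nu>) - Const (eta_bar \<alpha> N \<nu> i) * monom \<nu> \<in> lower N \<nu>"
proof -
  let ?u = "\<lambda>p. of_bool (look \<nu> p < look \<nu> i) :: real" and ?v = "\<lambda>p. of_bool (look \<nu> i < look \<nu> p) :: real"
  have A: "(\<Sum>p\<in>{1..<i}. Z i * div_diff i p (monom \<nu>) - Const (?u p) * monom \<nu>) \<in> lower N \<nu>"
    using i c by (intro lower_intros Z_div_diff_less) auto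
  have B: "(\<Sum>p\<in>{i<..N}. Z p * div_diff i p (monom \<nu>) + Const (?v p) * monom \<nu>) \<in> lower N \<nu>"
    using i c by (intro lower_intros Z_div_diff_greater) auto
  have S: "Const (sum h A) = (\<Sum>p\<in>A. Const (h p))" for h and A :: "nat set"
    by (induction A rule: infinite_finite_induct) (simp_all add: Const_add)
  have E: "Const (eta_bar \<alpha> N \<nu> i) * monom \<nu> = Const \<alpha> * (Const (real (look \<nu> i)) * monom \<nu>)
      + (\<Sum>p\<in>{1..<i}. Const (?u p) * monom \<nu>) - (\<Sum>p\<in>{i<..N}. Const (?v p) * monom \<nu>)
      + Const (1 - real i) * monom \<nu>"
    using i by (subst eta_bar_alt)
      (simp_all only: atLeastAtMost_iff Const_add Const_diff S distrib_right left_diff_distrib sum_distrib_right Const_mult mult.assoc)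
  have "cherednik \<alpha> N i (monom \<nu>) - Const (eta_bar \<alpha> N \<nu> i) * monom \<nu>
     = (\<Sum>p\<in>{1..<i}. Z i * div_diff i p (monom \<nu>) - Const (?u p) * monom \<nu>)
     + (\<Sum>p\<in>{i<..N}. Z p * div_diff i p (monom \<nu>) + Const (?v p) * monom \<nu>)"
    unfolding cherednik_def E mult.assoc[of "Const \<alpha>" "Z i"] Z_partial_deriv_monom sum.distrib sum_subtractf
    by simp
  with A B show ?thesis by (simp add: lower_intros)
qed

text \<open>\<open>eta_bar \<alpha> N \<eta> i\<close> is \<open>\<alpha> \<eta>\<^sub>i\<close> minus the number of entries that beat the \<open>i\<close>-th one.\<close>

definition beats :: "comp \<Rightarrow> nat \<Rightarrow> nat \<Rightarrow> bool" where
  "beats \<eta> k i \<longleftrightarrow> look \<eta> i < look \<eta> k \<or> look \<eta> i = look \<eta> k \<and> k < i"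

lemma eta_bar_rank:
  assumes "i \<in> {1..N}"
  shows "eta_bar \<alpha> N \<eta> i = \<alpha> * real (look \<eta> i) - real (card {k\<in>{1..N}. beats \<eta> k i})"
proof -
  have *: "beats \<eta> k i \<longleftrightarrow> k < i \<and> look \<eta> k \<ge> look \<eta> i \<or> i < k \<and> look \<eta> k > look \<eta> i" for k
    by (cases k i rule: linorder_cases) (auto simp: beats_def)
  have U: "{k\<in>{1..N}. beats \<eta> k i} = {k\<in>{1..<i}. look \<eta> k \<ge> look \<eta> i} \<union> {k\<in>{i<..N}. look \<eta> k > look \<eta> i}"
    unfolding * using assms by auto
  have "card {k\<in>{1..N}. beats \<eta> k i} = card {k\<in>{1..<i}. look \<eta> k \<ge> look \<eta> i} + card {k\<in>{i<..N}. look \<eta> k > look \<eta> i}"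
    unfolding U by (rule card_Un_disjoint) auto
  then show ?thesis by (simp add: eta_bar_def)
qed

text \<open>The relation \<open>beats\<close> is transitive: whatever beats k also beats i, and k
  itself is one more.\<close>

lemma eta_bar_beats:
  assumes "k \<in> {1..N}" "i \<in> {1..N}" "beats \<eta> k i"
  shows "eta_bar \<alpha> N \<eta> i + 1 + \<alpha> * (real (look \<eta> k) - real (look \<eta> i)) \<le> eta_bar \<alpha> N \<eta> k"
proof -
  have "card (insert k {j\<in>{1..N}. beats \<eta> j k}) \<le> card {j\<in>{1..N}. beats \<eta> j i}"
    using assms by (intro card_mono) (auto simp: beats_def)
  moreover have "card (insert k {j\<in>{1..N}. beats \<eta> j k}) = Suc (card {j\<in>{1..N}. beats \<eta> j k})"
    by (rule card_insert_disjoint) (auto simp: beats_def)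
  ultimately show ?thesis using assms by (simp add: eta_bar_rank algebra_simps)
qed

text \<open>Adjacent positions with equal entries are neighbours in the ranking.\<close>

lemma eta_bar_tie:
  assumes "1 \<le> k" "k < N" "look \<eta> k = look \<eta> (Suc k)"
  shows "eta_bar \<alpha> N \<eta> k = eta_bar \<alpha> N \<eta> (Suc k) + 1"
proof -
  have "{j\<in>{1..N}. beats \<eta> j (Suc k)} = insert k {j\<in>{1..N}. beats \<eta> j k}"
    using assms by (auto simp: beats_def)
  moreover have "card (insert k {j\<in>{1..N}. beats \<eta> j k}) = Suc (card {j\<in>{1..N}. beats \<eta> j k})"
    by (rule card_insert_disjoint) (auto simp: beats_def)
  ultimately show ?thesis using assms by (simp add: eta_bar_rank)
qed

text \<open>For \<alpha> > 0 the order of the eigenvalues is the ranking \<open>beats\<close>. The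
  eigenvalues thus determine all ranks, and then the entries.\<close>

lemma eta_bar_inj:
  assumes "\<alpha> > 0" "composition N \<nu>" "composition N \<eta>"
    and eq: "\<And>i. i \<in> {1..N} \<Longrightarrow> eta_bar \<alpha> N \<nu> i = eta_bar \<alpha> N \<eta> i"
  shows "\<nu> = \<eta>"
proof (rule composition_eqI[OF assms(2,3)])
  have *: "beats \<kappa> k i \<longleftrightarrow> eta_bar \<alpha> N \<kappa> i < eta_bar \<alpha> N \<kappa> k" if "k \<in> {1..N}" "i \<in> {1..N}" for \<kappa> k i
  proof -
    have 1: "eta_bar \<alpha> N \<kappa> y < eta_bar \<alpha> N \<kappa> x" if "beats \<kappa> x y" "x \<in> {1..N}" "y \<in> {1..N}" for x y
    proof -
      have "0 \<le> \<alpha> * (real (look \<kappa> x) - real (look \<kappa> y))" using that(1) assms(1) by (auto simp: beats_def)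
      then show ?thesis using eta_bar_beats[OF that(2,3,1), of \<alpha>] by linarith
    qed
    consider "beats \<kappa> k i" | "beats \<kappa> i k" | "k = i"
      unfolding beats_def by (metis linorder_neqE_nat)
    then show ?thesis using 1[of k i] 1[of i k] that by cases (auto simp: beats_def)
  qed
  fix i assume i: "i \<in> {1..N}"
  have "{k\<in>{1..N}. beats \<nu> k i} = {k\<in>{1..N}. beats \<eta> k i}" using * i eq by auto
  then have "\<alpha> * real (look \<nu> i) = \<alpha> * real (look \<eta> i)" using eq[OF i] i by (simp add: eta_bar_rank)
  then show "look \<nu> i = look \<eta> i" using assms(1) by simp
qed

lemma eta_bar_transfer:
  assumes w: "w permutes {1..N}" and i: "i \<in> {1..N}"
    and b: "\<And>j. j \<in> {1..N} \<Longrightarrow> beats \<eta>' (w j) (w i) \<longleftrightarrow> beats \<eta> j i"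
  shows "eta_bar \<alpha> N \<eta>' (w i) - \<alpha> * real (look \<eta>' (w i)) = eta_bar \<alpha> N \<eta> i - \<alpha> * real (look \<eta> i)"
proof -
  have "{k\<in>{1..N}. beats \<eta>' k (w i)} = w ` {k\<in>{1..N}. beats \<eta> k i}"
  proof (intro equalityI subsetI)
    fix k assume k: "k \<in> {k\<in>{1..N}. beats \<eta>' k (w i)}"
    then obtain j where "k = w j" "j \<in> {1..N}" using permutes_image[OF w] by blast
    then show "k \<in> w ` {k\<in>{1..N}. beats \<eta> k i}" using k b by auto
  qed (use b permutes_in_image[OF w] in auto)
  then have "card {k\<in>{1..N}. beats \<eta>' k (w i)} = card {k\<in>{1..N}. beats \<eta> k i}"
    by (simp add: card_image permutes_inj_on[OF w])
  then show ?thesis using i permutes_in_image[OF w, of i] by (simp add: eta_bar_rank)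
qed

lemma eta_bar_swap:
  assumes k: "1 \<le> k" "k < N" and ne: "look \<eta> k \<noteq> look \<eta> (Suc k)" and i: "i \<in> {1..N}"
  shows "eta_bar \<alpha> N (perm_comp (transpose k (Suc k)) \<eta>) i = eta_bar \<alpha> N \<eta> (transpose k (Suc k) i)"
proof -
  let ?s = "transpose k (Suc k)"
  have s: "?s permutes {1..N}" using k by (intro permutes_swap_id) auto
  have si: "?s i \<in> {1..N}" using i permutes_in_image[OF s] by blast
  \<comment> \<open>Ties are broken by position, and s_k reverses only the positions k and k + 1,
    which are not tied.\<close>
  have "?s j < ?s m \<longleftrightarrow> j < m" if "look \<eta> m = look \<eta> j" for j m
    using ne that
    by (cases "j = k"; cases "j = Suc k"; cases "m = k"; cases "m = Suc k") (simp_all add: transpose_def, linarith+)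
  moreover have "look (perm_comp ?s \<eta>) (?s j) = look \<eta> j" for j
    by (simp add: look_perm_comp)
  ultimately have "beats (perm_comp ?s \<eta>) (?s j) (?s m) \<longleftrightarrow> beats \<eta> j m" for j m
    unfolding beats_def by metis
  then have "eta_bar \<alpha> N (perm_comp ?s \<eta>) (?s (?s i)) - \<alpha> * real (look (perm_comp ?s \<eta>) (?s (?s i)))
    = eta_bar \<alpha> N \<eta> (?s i) - \<alpha> * real (look \<eta> (?s i))"
    by (intro eta_bar_transfer[OF s si])
  then show ?thesis by (simp add: look_perm_comp)
qed

definition Phi_comp :: "nat \<Rightarrow> comp \<Rightarrow> comp" where
  "Phi_comp N \<eta> = perm_comp (rot N) \<eta> + Poly_Mapping.single N 1"

text \<open>Raising the first entry by one compensates its move to the end: ties it used to win by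
  position are now won by value, and entries larger by one now win by position.\<close>

lemma eta_bar_Phi:
  assumes i: "i \<in> {1..N}"
  shows "eta_bar \<alpha> N (Phi_comp N \<eta>) (rot N i) = eta_bar \<alpha> N \<eta> i + (if i = 1 then \<alpha> else 0)"
proof -
  have r: "rot N permutes {1..N}" using i by (intro rot_permutes) auto
  have L: "look (Phi_comp N \<eta>) (rot N j) = look \<eta> j + (if j = 1 then 1 else 0)" if "j \<in> {1..N}" for j
  proof -
    have "N = rot N j \<longleftrightarrow> j = 1" using that by (auto simp: rot_def)
    then show ?thesis
      by (simp add: Phi_comp_def lookup_add look_perm_comp permutes_bij[OF r] permutes_inverses(2)[OF r]
          lookup_single when_def)
  qed
  have "beats (Phi_comp N \<eta>) (rot N j) (rot N i) \<longleftrightarrow> beats \<eta> j i" if "j \<in> {1..N}" for j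
    unfolding beats_def L[OF that] L[OF i] using that i by (auto simp: rot_def)
  then have "eta_bar \<alpha> N (Phi_comp N \<eta>) (rot N i) - \<alpha> * real (look (Phi_comp N \<eta>) (rot N i))
      = eta_bar \<alpha> N \<eta> i - \<alpha> * real (look \<eta> i)"
    by (intro eta_bar_transfer[OF r i])
  then show ?thesis unfolding L[OF i] by (auto simp: algebra_simps)
qed

definition eigen :: "real \<Rightarrow> nat \<Rightarrow> (nat \<Rightarrow> real) \<Rightarrow> mpol \<Rightarrow> bool" where
  "eigen \<alpha> N x f \<longleftrightarrow> (\<forall>\<kappa>\<in>supp f. composition N \<kappa>) \<and>
     (\<forall>i\<in>{1..N}. cherednik \<alpha> N i f = Const (x i) * f)"

lemma eigen_cong: "(\<And>i. i \<in> {1..N} \<Longrightarrow> x i = y i) \<Longrightarrow> eigen \<alpha> N x f \<Longrightarrow> eigen \<alpha> N y f"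
  by (simp add: eigen_def)

lemma eigen_scale: "eigen \<alpha> N x f \<Longrightarrow> eigen \<alpha> N x (Const c * f)"
  by (auto simp: eigen_def lin_scale[OF lin_cherednik] in_keys_iff mult.commute[of c])

lemma eigen_diff: "eigen \<alpha> N x f \<Longrightarrow> eigen \<alpha> N x g \<Longrightarrow> eigen \<alpha> N x (f - g)"
  unfolding eigen_def lin_diff[OF lin_cherednik] right_diff_distrib
  by (auto simp: in_keys_iff lookup_minus)

text \<open>By triangularity no other monomial of f can contribute to z^\<nu> in xi_i f when \<nu>
  is maximal, so the eigenvalue is read off from the diagonal.\<close>

lemma eigen_maximal_key:
  assumes f: "eigen \<alpha> N x f" and \<nu>: "\<nu> \<in> supp f" and max: "\<And>\<kappa>. \<kappa> \<in> supp f \<Longrightarrow> \<not> below N \<nu> \<kappa>"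
    and i: "i \<in> {1..N}"
  shows "x i = eta_bar \<alpha> N \<nu> i"
proof -
  have *: "look (cherednik \<alpha> N i (monom \<kappa>)) \<nu> = (if \<kappa> = \<nu> then eta_bar \<alpha> N \<nu> i else 0)" if "\<kappa> \<in> supp f" for \<kappa>
  proof -
    have c: "composition N \<kappa>" using f that by (simp add: eigen_def)
    have "look (cherednik \<alpha> N i (monom \<kappa>) - Const (eta_bar \<alpha> N \<kappa> i) * monom \<kappa>) \<nu> = 0"
      using cherednik_monom[OF c i, of \<alpha>] max[OF that] by (auto simp: lower_def in_keys_iff)
    then show ?thesis by (auto simp: lookup_minus look_monom split: if_splits)
  qed
  have "cherednik \<alpha> N i f = (\<Sum>\<kappa>\<in>supp f. Const (look f \<kappa>) * cherednik \<alpha> N i (monom \<kappa>))"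
    by (subst mpol_expand[of f]) (simp only: lin_sum[OF lin_cherednik] lin_scale[OF lin_cherednik])
  moreover have "look (cherednik \<alpha> N i f) \<nu> = x i * look f \<nu>" using f i by (simp add: eigen_def)
  ultimately have "x i * look f \<nu> = (\<Sum>\<kappa>\<in>supp f. look f \<kappa> * (if \<kappa> = \<nu> then eta_bar \<alpha> N \<nu> i else 0))"
    by (simp add: look_sum *)
  also have "\<dots> = look f \<nu> * eta_bar \<alpha> N \<nu> i"
    using \<nu> by (simp add: if_distrib cong: if_cong)
  finally show ?thesis using \<nu> by (auto simp: in_keys_iff)
qed

lemma ex_maximal_above:
  assumes "finite A" "\<kappa> \<in> A"
  obtains \<nu> where "\<nu> \<in> A" "below_eq N \<kappa> \<nu>" "\<And>\<mu>. \<mu> \<in> A \<Longrightarrow> \<not> below N \<nu> \<mu>"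
proof -
  let ?B = "{\<nu>\<in>A. below_eq N \<kappa> \<nu>}"
  have "asymp_on ?B (below N)"
    by (rule asymp_onI) (metis below_irrefl below_trans)
  moreover have "transp_on ?B (below N)"
    by (rule transp_onI) (metis below_trans)
  moreover have "finite ?B" "?B \<noteq> {}" using assms by auto
  ultimately obtain \<nu> where \<nu>: "\<nu> \<in> ?B" "\<forall>\<mu>\<in>?B. \<mu> \<noteq> \<nu> \<longrightarrow> \<not> below N \<nu> \<mu>"
    using Finite_Set.bex_max_element[of ?B "below N"] by blast
  show ?thesis
  proof (rule that[of \<nu>])
    fix \<mu> assume \<mu>: "\<mu> \<in> A"
    show "\<not> below N \<nu> \<mu>"
    proof
      assume b: "below N \<nu> \<mu>"
      then have "\<mu> \<in> ?B" using \<nu>(1) \<mu> below_trans by blast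
      with b \<nu>(2) show False using below_irrefl[of N \<nu>] by metis
    qed
  qed (use \<nu>(1) in auto)
qed

text \<open>With c in place of 1/\<delta>, applying xi_k leaves the error (1 - c \<delta>) f; this
  fixes the constant. The result may be zero, and its vanishing is a separate question.\<close>

lemma eigen_swap:
  assumes k: "1 \<le> k" "k < N" and f: "eigen \<alpha> N x f" and \<delta>: "\<delta> = x k - x (Suc k)" "\<delta> \<noteq> 0"
  shows "eigen \<alpha> N (x \<circ> transpose k (Suc k)) (act (transpose k (Suc k)) f - Const (1 / \<delta>) * f)"
proof -
  let ?s = "transpose k (Suc k)"
  have s: "?s permutes {1..N}" using k by (intro permutes_swap_id) auto
  have keys: "composition N \<kappa>" if "\<kappa> \<in> supp (act ?s f - Const (1 / \<delta>) * f)" for \<kappa>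
  proof -
    have "look f \<kappa> \<noteq> 0 \<or> look f (perm_comp ?s \<kappa>) \<noteq> 0"
      using that by (auto simp: in_keys_iff lookup_minus look_act)
    then have "composition N \<kappa> \<or> composition N (perm_comp ?s \<kappa>)" using f by (auto simp: eigen_def in_keys_iff)
    then show ?thesis
      using composition_perm[OF s] perm_comp_inv[OF permutes_bij[OF s], of \<kappa>] by (metis inv_transpose_eq)
  qed
  have ev: "cherednik \<alpha> N i f = Const (x i) * f" if "i \<in> {1..N}" for i using f that by (simp add: eigen_def)
  have "cherednik \<alpha> N i (act ?s f - Const (1 / \<delta>) * f) = Const (x (?s i)) * (act ?s f - Const (1 / \<delta>) * f)"
    if i: "i \<in> {1..N}" for i
  proof -
    have *: "Const a * f' + f - Const b * (Const c * f) = Const a * (f' - Const b * f)"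
      if "1 = b * c - a * b" for a b c f'
    proof -
      have "f = Const (b * c - a * b) * f" using that by simp
      also have "\<dots> = Const b * (Const c * f) - Const a * (Const b * f)"
        by (simp only: Const_diff Const_mult left_diff_distrib mult.assoc)
      finally show ?thesis by (simp add: algebra_simps)
    qed
    consider "i = k" | "i = Suc k" | "i \<noteq> k" "i \<noteq> Suc k" by blast
    then show ?thesis
    proof cases
      case 1
      have "cherednik \<alpha> N i (act ?s f - Const (1 / \<delta>) * f)
          = Const (x (Suc k)) * act ?s f + f - Const (1 / \<delta>) * (Const (x k) * f)"
        using k 1 by (simp only: lin_diff[OF lin_cherednik] lin_scale[OF lin_cherednik] cherednik_swap) (simp add: ev)
      also have "\<dots> = Const (x (Suc k)) * (act ?s f - Const (1 / \<delta>) * f)"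
        by (rule *) (use \<delta> in \<open>simp add: field_simps\<close>)
      finally show ?thesis using 1 by simp
    next
      case 2
      have **: "Const a * f' - f - Const b * (Const c * f) = Const a * (f' - Const b * f)"
        if "- 1 = b * c - a * b" for a b c f'
      proof -
        have "- f = Const (b * c - a * b) * f" using that[symmetric] by simp
        also have "\<dots> = Const b * (Const c * f) - Const a * (Const b * f)"
          by (simp only: Const_diff Const_mult left_diff_distrib mult.assoc)
        finally show ?thesis by (simp add: right_diff_distrib)
      qed
      have "cherednik \<alpha> N i (act ?s f - Const (1 / \<delta>) * f)
          = Const (x k) * act ?s f - f - Const (1 / \<delta>) * (Const (x (Suc k)) * f)"
        using k 2 by (simp only: lin_diff[OF lin_cherednik] lin_scale[OF lin_cherednik] cherednik_swap') (simp add: ev)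
      also have "\<dots> = Const (x k) * (act ?s f - Const (1 / \<delta>) * f)"
        by (rule **) (use \<delta> in \<open>simp add: field_simps\<close>)
      finally show ?thesis using 2 by simp
    next
      case 3
      have "cherednik \<alpha> N i (act ?s f - Const (1 / \<delta>) * f)
          = Const (x i) * act ?s f - Const (1 / \<delta>) * (Const (x i) * f)"
        using k 3 i by (simp only: lin_diff[OF lin_cherednik] lin_scale[OF lin_cherednik] cherednik_swap_other[OF k i 3]) (simp add: ev)
      then show ?thesis using 3 by (simp add: right_diff_distrib mult.commute)
    qed
  qed
  then show ?thesis using keys by (simp add: eigen_def)
qed

lemma eigen_Phi:
  assumes N: "1 \<le> N" and f: "eigen \<alpha> N (eta_bar \<alpha> N \<kappa>) f"
  shows "eigen \<alpha> N (eta_bar \<alpha> N (Phi_comp N \<kappa>)) (Phi N f)"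
proof -
  note r = rot_permutes[OF N]
  have keys: "composition N \<mu>" if \<mu>: "\<mu> \<in> supp (Phi N f)" for \<mu>
  proof -
    obtain \<nu> where \<nu>: "\<mu> = Poly_Mapping.single N 1 + \<nu>" "\<nu> \<in> supp (act (rot N) f)"
      using \<mu> keys_mult[of "Z N" "act (rot N) f"] unfolding Phi_def by (auto simp: Z_def monom_def split: if_splits)
    have "look f (perm_comp (inv (rot N)) \<nu>) \<noteq> 0"
      using \<nu>(2) by (simp add: in_keys_iff look_act permutes_bij[OF r])
    then have "composition N (perm_comp (inv (rot N)) \<nu>)" using f by (simp add: eigen_def in_keys_iff)
    then have "composition N \<nu>"
      using composition_perm[OF r] perm_comp_inv[OF permutes_bij[OF r], of \<nu>] by metis
    then show ?thesis using \<nu>(1) N by (auto simp: composition_iff lookup_add lookup_single when_def)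
  qed
  have ev: "cherednik \<alpha> N i f = Const (eta_bar \<alpha> N \<kappa> i) * f" if "i \<in> {1..N}" for i using f that by (simp add: eigen_def)
  have PC: "Phi N (Const c * f) = Const c * Phi N f" for c by (simp add: Phi_def mult.left_commute)
  have "cherednik \<alpha> N i (Phi N f) = Const (eta_bar \<alpha> N (Phi_comp N \<kappa>) i) * Phi N f" if i: "i \<in> {1..N}" for i
  proof (cases "i = N")
    case True
    have "rot N 1 = N" by (simp add: rot_def)
    then have "eta_bar \<alpha> N (Phi_comp N \<kappa>) N = eta_bar \<alpha> N \<kappa> 1 + \<alpha>" using eta_bar_Phi[of 1 N \<alpha> \<kappa>] N by simp
    moreover have "cherednik \<alpha> N N (Phi N f) = Phi N (Const (eta_bar \<alpha> N \<kappa> 1 + \<alpha>) * f)"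
      using ev[of 1] N by (simp add: cherednik_Phi_last Const_add distrib_right)
    ultimately show ?thesis using True PC by simp
  next
    case False
    then have "rot N (Suc i) = i" using i by (simp add: rot_def)
    then have "eta_bar \<alpha> N (Phi_comp N \<kappa>) i = eta_bar \<alpha> N \<kappa> (Suc i)" using eta_bar_Phi[of "Suc i" N \<alpha> \<kappa>] i False by simp
    then show ?thesis using i False ev[of "Suc i"] by (simp add: cherednik_Phi PC)
  qed
  then show ?thesis using keys by (simp add: eigen_def)
qed

lemma weight_perm: "w permutes {1..N} \<Longrightarrow> weight N (perm_comp w \<mu>) = weight N \<mu>"
  by (simp add: weight_excess excess_entries entries_perm)

text \<open>Weights decrease from left to right, so removing a descent lowers the sum. It serves as
  termination measure for the recursions through an orbit.\<close>

lemma swap_measure: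
  assumes k: "1 \<le> k" "k < N" and gt: "look \<mu> (Suc k) < look \<mu> k"
  shows "(\<Sum>j=1..N. (N - j) * look (perm_comp (transpose k (Suc k)) \<mu>) j) < (\<Sum>j=1..N. (N - j) * look \<mu> j)"
proof -
  let ?s = "transpose k (Suc k)" and ?R = "{1..N} - {k, Suc k}"
  have I: "{1..N} = insert k (insert (Suc k) ?R)" using k by auto
  have split: "(\<Sum>j=1..N. f j) = f k + (f (Suc k) + (\<Sum>j\<in>?R. f j))" for f :: "nat \<Rightarrow> nat"
    by (subst I) simp
  have "(\<Sum>j\<in>?R. (N - j) * look (perm_comp ?s \<mu>) j) = (\<Sum>j\<in>?R. (N - j) * look \<mu> j)"
    by (intro sum.cong) (auto simp: look_perm_comp)
  moreover obtain d where d: "N - k = Suc d" "N - Suc k = d" using k by (metis Suc_diff_Suc)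
  ultimately show ?thesis using gt unfolding split d by (simp add: look_perm_comp)
qed

section \<open>Existence, uniqueness and exchange relations for positive \<alpha>\<close>

context
  fixes \<alpha> :: real and N :: nat
  assumes \<alpha>: "\<alpha> > 0"
begin

text \<open>Any maximal exponent carries the eigenvalues of \<eta>, which separate compositions; so
  \<eta> is the only maximal exponent.\<close>

lemma eigen_keys:
  assumes f: "eigen \<alpha> N (eta_bar \<alpha> N \<eta>) f" and \<eta>: "composition N \<eta>" and \<kappa>: "\<kappa> \<in> supp f"
  shows "\<eta> \<in> supp f" "below_eq N \<kappa> \<eta>"
proof -
  obtain \<nu> where \<nu>: "\<nu> \<in> supp f" "below_eq N \<kappa> \<nu>" "\<And>\<mu>. \<mu> \<in> supp f \<Longrightarrow> \<not> below N \<nu> \<mu>"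
    using ex_maximal_above[OF finite_keys \<kappa>] by metis
  have "\<nu> = \<eta>"
    using eigen_maximal_key[OF f \<nu>(1,3)] f \<nu>(1) by (intro eta_bar_inj[OF \<alpha> _ \<eta>]) (auto simp: eigen_def)
  with \<nu> show "\<eta> \<in> supp f" "below_eq N \<kappa> \<eta>" by auto
qed

lemma eigen_eq_0: "eigen \<alpha> N (eta_bar \<alpha> N \<eta>) f \<Longrightarrow> composition N \<eta> \<Longrightarrow> look f \<eta> = 0 \<Longrightarrow> f = 0"
  using eigen_keys(1) by (metis in_keys_iff keys_eq_empty equals0I)

text \<open>The rank alone gives a gap of at least 1, and \<alpha> > 0 makes it strictly larger. So
  1/\<delta> lies strictly between -1 and 0.\<close>

lemma eta_bar_swap_bound:
  assumes k: "1 \<le> k" "k < N" and lt: "look \<mu> k < look \<mu> (Suc k)"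
  shows "eta_bar \<alpha> N \<mu> k - eta_bar \<alpha> N \<mu> (Suc k) < - 1"
proof -
  have "0 < \<alpha> * (real (look \<mu> (Suc k)) - real (look \<mu> k))" using lt \<alpha> by simp
  then show ?thesis using eta_bar_beats[of "Suc k" N k \<mu> \<alpha>] k lt by (simp add: beats_def)
qed

lemma eigen_swap_up:
  assumes k: "1 \<le> k" "k < N" and lt: "look \<mu> k < look \<mu> (Suc k)" and c: "composition N \<mu>"
    and f: "eigen \<alpha> N (eta_bar \<alpha> N \<mu>) f" and \<delta>: "\<delta> = eta_bar \<alpha> N \<mu> k - eta_bar \<alpha> N \<mu> (Suc k)"
  defines "\<eta> \<equiv> perm_comp (transpose k (Suc k)) \<mu>" and "g \<equiv> act (transpose k (Suc k)) f - Const (1 / \<delta>) * f"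
  shows "eigen \<alpha> N (eta_bar \<alpha> N \<eta>) g" "look g \<eta> = look f \<mu>"
proof -
  let ?s = "transpose k (Suc k)"
  have s: "?s permutes {1..N}" using k by (intro permutes_swap_id) auto
  have "\<delta> \<noteq> 0" using eta_bar_swap_bound[OF k lt] \<delta> by simp
  then have "eigen \<alpha> N (eta_bar \<alpha> N \<mu> \<circ> ?s) g"
    unfolding g_def by (intro eigen_swap[OF k f \<delta>])
  then show "eigen \<alpha> N (eta_bar \<alpha> N \<eta>) g"
    by (rule eigen_cong[rotated]) (use eta_bar_swap[OF k] lt in \<open>simp add: \<eta>_def\<close>)
  have \<mu>: "perm_comp ?s \<eta> = \<mu>" by (simp add: \<eta>_def perm_comp_comp)
  have "below N (perm_comp ?s \<eta>) \<eta>"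
    using k lt composition_perm[OF s c] by (intro below_swap) (simp_all add: \<eta>_def look_perm_comp)
  then have "below N \<mu> \<eta>" by (simp add: \<mu>)
  then have "\<not> below_eq N \<eta> \<mu>" using below_trans below_irrefl by metis
  \<comment> \<open>As \<eta> is above \<mu>, its monomial is absent from f, and the leading
    coefficient comes from the swapped f alone.\<close>
  then have "look f \<eta> = 0" using eigen_keys(2)[OF f c] by (auto simp: in_keys_iff)
  then show "look g \<eta> = look f \<mu>" by (simp add: g_def lookup_minus look_act \<mu>)
qed

text \<open>A descent is reached from the swapped composition by the intertwiner. Without descents
  the last entry is the largest, so either \<eta> = 0 or the affine intertwiner reaches \<eta> from
  smaller weight.\<close>

lemma ex_eigen:
  assumes "composition N \<eta>"
  shows "\<exists>f. eigen \<alpha> N (eta_bar \<alpha> N \<eta>) f \<and> f \<noteq> 0"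
  using assms
proof (induction "(weight N \<eta>, \<Sum>j=1..N. (N - j) * look \<eta> j)" arbitrary: \<eta>
    rule: wf_induct_rule[OF wf_lex_prod[OF wf_less_than wf_less_than]])
  case 1
  note c = \<open>composition N \<eta>\<close>
  have IH: "\<exists>f. eigen \<alpha> N (eta_bar \<alpha> N \<kappa>) f \<and> f \<noteq> 0"
    if "composition N \<kappa>" "weight N \<kappa> < weight N \<eta> \<or> weight N \<kappa> = weight N \<eta> \<and>
      (\<Sum>j=1..N. (N - j) * look \<kappa> j) < (\<Sum>j=1..N. (N - j) * look \<eta> j)" for \<kappa>
    using 1(1) that by simp
  show ?case
  proof (cases "\<exists>k. 1 \<le> k \<and> k < N \<and> look \<eta> (Suc k) < look \<eta> k")
    case True
    then obtain k where k: "1 \<le> k" "k < N" and gt: "look \<eta> (Suc k) < look \<eta> k" by blast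
    let ?s = "transpose k (Suc k)"
    let ?\<mu> = "perm_comp ?s \<eta>"
    have s: "?s permutes {1..N}" using k by (intro permutes_swap_id) auto
    have c': "composition N ?\<mu>" by (rule composition_perm[OF s c])
    obtain f where f: "eigen \<alpha> N (eta_bar \<alpha> N ?\<mu>) f" "f \<noteq> 0"
      using IH[OF c'] swap_measure[OF k gt] weight_perm[OF s] by auto
    have "look f ?\<mu> \<noteq> 0" using eigen_eq_0[OF f(1) c'] f(2) by blast
    moreover have "perm_comp ?s ?\<mu> = \<eta>" by (simp add: perm_comp_comp)
    moreover have "look ?\<mu> k < look ?\<mu> (Suc k)" using gt by (simp add: look_perm_comp)
    ultimately show ?thesis
      using eigen_swap_up[OF k _ c' f(1) refl] by (metis lookup_zero)
  next
    case False
    have mono: "look \<eta> j \<le> look \<eta> N" if "1 \<le> j" "j \<le> N" for j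
      using that(2,1)
    proof (induction j rule: inc_induct)
      case (step n)
      then have "look \<eta> n \<le> look \<eta> (Suc n)" using False by (meson not_le_imp_less)
      with step show ?case by simp
    qed simp
    show ?thesis
    proof (cases "look \<eta> N = 0")
      case True
      have "look \<eta> j = 0" for j
        using True mono[of j] compositionD[OF c, of j] by (cases "j \<in> {1..N}") auto
      then have "\<eta> = 0" by (intro poly_mapping_eqI) simp
      \<comment> \<open>Nothing lies below the zero composition, so triangularity makes the constant
        1 an eigenfunction.\<close>
      have "supp g = {}" if "g \<in> lower N 0" for g
      proof -
        have "\<not> below N \<kappa> 0" for \<kappa>
        proof
          assume b: "below N \<kappa> 0"
          then have "weight N \<kappa> = 0" by (simp add: below_def weight_def)
          then have "\<kappa> = 0" using b by (intro composition_eqI[of N]) (auto simp: weight_def below_def)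
          with b show False using below_irrefl by blast
        qed
        with that show ?thesis by (auto simp: lower_def)
      qed
      then have "g = 0" if "g \<in> lower N 0" for g using that by simp
      from this[OF cherednik_monom] have "eigen \<alpha> N (eta_bar \<alpha> N 0) (monom 0)"
        using c unfolding \<open>\<eta> = 0\<close> by (auto simp: eigen_def monom_def)
      moreover have "monom 0 \<noteq> 0" by (rule monom_nonzero)
      ultimately show ?thesis unfolding \<open>\<eta> = 0\<close> by blast
    next
      case ne: False
      then have N: "1 \<le> N" using compositionD[OF c, of N] by force
      note r = rot_permutes[OF N]
      \<comment> \<open>The preimage of \<eta> under \<open>Phi_comp\<close>: take one unit from the
        positive last entry and rotate back.\<close>
      define \<kappa> where "\<kappa> = perm_comp (inv (rot N)) (\<eta> - Poly_Mapping.single N 1)"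
      have c': "composition N (\<eta> - Poly_Mapping.single N 1)"
        using c by (simp add: composition_iff lookup_minus)
      have \<kappa>: "composition N \<kappa>" unfolding \<kappa>_def by (rule composition_perm[OF permutes_inv[OF r] c'])
      have \<eta>: "\<eta> - Poly_Mapping.single N 1 + Poly_Mapping.single N 1 = \<eta>"
        using ne by (intro poly_mapping_eqI) (auto simp: lookup_minus lookup_add lookup_single when_def)
      then have P: "Phi_comp N \<kappa> = \<eta>"
        by (simp add: Phi_comp_def \<kappa>_def perm_comp_inv[OF permutes_bij[OF r]])
      have "weight N \<eta> = weight N (\<eta> - Poly_Mapping.single N 1) + weight N (Poly_Mapping.single N 1)"
        by (subst \<eta>[symmetric]) (simp only: weight_def lookup_add sum.distrib)
      moreover have "weight N (Poly_Mapping.single N 1) = 1"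
        using N by (simp add: weight_def lookup_single when_def)
      ultimately have "weight N \<kappa> < weight N \<eta>"
        using weight_perm[OF permutes_inv[OF r]] by (simp add: \<kappa>_def)
      then obtain f where f: "eigen \<alpha> N (eta_bar \<alpha> N \<kappa>) f" "f \<noteq> 0" using IH[OF \<kappa>] by blast
      have "act (rot N) f \<noteq> 0"
      proof
        assume "act (rot N) f = 0"
        then have "act (inv (rot N)) (act (rot N) f) = 0" by simp
        then show False
          using f(2) permutes_bij[OF r] by (simp add: act_comp bij_imp_bij_inv bij_is_inj)
      qed
      then have "Phi N f \<noteq> 0" by (simp add: Phi_def Z_def monom_nonzero)
      then show ?thesis using eigen_Phi[OF N f(1)] P by metis
    qed
  qed
qed

abbreviation (input) E :: "comp \<Rightarrow> mpol" where "E \<equiv> nonsym_jack \<alpha> N"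

text \<open>Separation of eigenvalues already yields the support condition, and a second candidate
  differs by an eigenfunction without leading term.\<close>

lemma nonsym_jack_eqI:
  assumes c: "composition N \<eta>" and f: "eigen \<alpha> N (eta_bar \<alpha> N \<eta>) f" "look f \<eta> = 1"
  shows "E \<eta> = f"
  unfolding nonsym_jack_def
proof (rule the_equality)
  show "unitriangular N \<eta> f \<and> (\<forall>i\<in>{1..N}. cherednik \<alpha> N i f = Const (eta_bar \<alpha> N \<eta> i) * f)"
    using f eigen_keys(2)[OF f(1) c] below_prec by (auto simp: unitriangular_def eigen_def)
next
  fix g assume g: "unitriangular N \<eta> g \<and> (\<forall>i\<in>{1..N}. cherednik \<alpha> N i g = Const (eta_bar \<alpha> N \<eta> i) * g)"
  then have "eigen \<alpha> N (eta_bar \<alpha> N \<eta>) g"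
    using c by (auto simp: unitriangular_def eigen_def prec_def)
  then have "eigen \<alpha> N (eta_bar \<alpha> N \<eta>) (g - f)" by (rule eigen_diff[OF _ f(1)])
  then have "g - f = 0"
    using g f(2) by (intro eigen_eq_0[OF _ c]) (auto simp: unitriangular_def lookup_minus)
  then show "g = f" by simp
qed

lemma nonsym_jack:
  assumes "composition N \<eta>"
  shows eigen_jack: "eigen \<alpha> N (eta_bar \<alpha> N \<eta>) (E \<eta>)" and look_jack: "look (E \<eta>) \<eta> = 1"
proof -
  obtain f where f: "eigen \<alpha> N (eta_bar \<alpha> N \<eta>) f" "f \<noteq> 0" using ex_eigen[OF assms] by blast
  then have "look f \<eta> \<noteq> 0" using eigen_eq_0[OF f(1) assms] by blast
  then have g: "eigen \<alpha> N (eta_bar \<alpha> N \<eta>) (Const (1 / look f \<eta>) * f)" "look (Const (1 / look f \<eta>) * f) \<eta> = 1"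
    using eigen_scale[OF f(1)] by simp_all
  show "eigen \<alpha> N (eta_bar \<alpha> N \<eta>) (E \<eta>)" "look (E \<eta>) \<eta> = 1"
    unfolding nonsym_jack_eqI[OF assms g] using g by blast+
qed

lemma jack_keys: "composition N \<eta> \<Longrightarrow> \<kappa> \<in> supp (E \<eta>) \<Longrightarrow> below_eq N \<kappa> \<eta>"
  using eigen_keys(2)[OF eigen_jack] by blast

lemma jack_swap_up:
  assumes k: "1 \<le> k" "k < N" and lt: "look \<mu> k < look \<mu> (Suc k)" and c: "composition N \<mu>"
  shows "E (perm_comp (transpose k (Suc k)) \<mu>) = act (transpose k (Suc k)) (E \<mu>)
    - Const (1 / (eta_bar \<alpha> N \<mu> k - eta_bar \<alpha> N \<mu> (Suc k))) * E \<mu>"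
proof -
  have s: "transpose k (Suc k) permutes {1..N}" using k by (intro permutes_swap_id) auto
  show ?thesis
    using eigen_swap_up[OF k lt c eigen_jack[OF c] refl] look_jack[OF c]
    by (intro nonsym_jack_eqI composition_perm[OF s c]) auto
qed

text \<open>Here \<delta> = 1, so s_k E - E is an eigenfunction whose gap at k is -1. Every
  composition has a gap of at least 1 or below -1, so no maximal exponent can exist.\<close>

lemma jack_swap_eq:
  assumes k: "1 \<le> k" "k < N" and eq: "look \<mu> k = look \<mu> (Suc k)" and c: "composition N \<mu>"
  shows "act (transpose k (Suc k)) (E \<mu>) = E \<mu>"
proof -
  let ?s = "transpose k (Suc k)"
  define g where "g = act ?s (E \<mu>) - E \<mu>"
  have \<delta>: "eta_bar \<alpha> N \<mu> k - eta_bar \<alpha> N \<mu> (Suc k) = 1" using eta_bar_tie[OF k eq] by simp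
  have g: "eigen \<alpha> N (eta_bar \<alpha> N \<mu> \<circ> ?s) g"
    using eigen_swap[OF k eigen_jack[OF c] \<delta>[symmetric]] by (simp add: g_def)
  have "supp g = {}"
  proof (rule ccontr)
    assume "supp g \<noteq> {}"
    then obtain \<kappa> where "\<kappa> \<in> supp g" by blast
    then obtain \<nu> where \<nu>: "\<nu> \<in> supp g" "\<And>\<mu>. \<mu> \<in> supp g \<Longrightarrow> \<not> below N \<nu> \<mu>"
      using ex_maximal_above[OF finite_keys] by metis
    note ev = eigen_maximal_key[OF g \<nu>]
    have "eta_bar \<alpha> N \<nu> k - eta_bar \<alpha> N \<nu> (Suc k) = - 1"
      using ev[of k] ev[of "Suc k"] k \<delta> by simp
    moreover have "eta_bar \<alpha> N \<nu> (Suc k) + 1 \<le> eta_bar \<alpha> N \<nu> k" if "look \<nu> (Suc k) < look \<nu> k"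
    proof -
      have "0 \<le> \<alpha> * (real (look \<nu> k) - real (look \<nu> (Suc k)))" using that \<alpha> by simp
      then show ?thesis using eta_bar_beats[of k N "Suc k" \<nu> \<alpha>] that k by (simp add: beats_def)
    qed
    ultimately show False
      using eta_bar_swap_bound[OF k, of \<nu>] eta_bar_tie[OF k, of \<nu> \<alpha>]
      by (cases "look \<nu> k" "look \<nu> (Suc k)" rule: linorder_cases) auto
  qed
  then show ?thesis by (simp add: g_def)
qed

end

section \<open>Prescribed symmetry\<close>

text \<open>The root e_j - e_l is the sum of the simple roots from j to l - 1, and it belongs to a
  block exactly when all of these do. This interval condition replaces the maximal blocks from here
  on.\<close>

lemma pos_roots_iff:
  assumes J: "J \<subseteq> {1..N - 1}"
  shows "(j, l) \<in> pos_roots N J \<longleftrightarrow> 1 \<le> j \<and> j < l \<and> l \<le> N \<and> {j..<l} \<subseteq> J"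
proof -
  have "(\<exists>B\<in>blocks J. j \<in> ext_block B \<and> l \<in> ext_block B) \<longleftrightarrow> {j..<l} \<subseteq> J" if "j < l"
  proof
    assume "\<exists>B\<in>blocks J. j \<in> ext_block B \<and> l \<in> ext_block B"
    then obtain a b where ab: "a \<le> b" "{a..b} \<subseteq> J" "j \<in> ext_block {a..b}" "l \<in> ext_block {a..b}"
      unfolding blocks_def consecutive_def by blast
    have "Max {a..b} = b" using ab(1) by (intro Max_eqI) auto
    then have "{j..<l} \<subseteq> {a..b}" using that ab by (auto simp: ext_block_def)
    with ab show "{j..<l} \<subseteq> J" by blast
  next
    assume le: "{j..<l} \<subseteq> J"
    let ?A = "{B. consecutive B \<and> B \<subseteq> J}"
    have "{j..<l} = {j..l - 1}" using that by auto
    moreover have "consecutive {j..l - 1}"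
      unfolding consecutive_def using that by (intro exI[of _ j] exI[of _ "l - 1"]) auto
    ultimately have "{j..l - 1} \<in> ?A" using le by auto
    moreover have "finite ?A"
      by (rule finite_subset[of _ "Pow J"]) (use finite_subset[OF J] in auto)
    \<comment> \<open>J is finite, so the interval extends to a maximal one, and that is a
      block.\<close>
    ultimately obtain B where B: "B \<in> ?A" "{j..l - 1} \<subseteq> B" "\<forall>B'\<in>?A. B \<subseteq> B' \<longrightarrow> B = B'"
      using finite_has_maximal2[of ?A "{j..l - 1}"] by blast
    then have "B \<in> blocks J" unfolding blocks_def by blast
    moreover have jB: "j \<in> B" "l - 1 \<in> B" using subsetD[OF B(2)] that by auto
    moreover have "j \<in> ext_block B" using jB by (simp add: ext_block_def)
    moreover have "l \<in> ext_block B"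
    proof -
      obtain a b where ab: "B = {a..b}" "a \<le> b" using B(1) unfolding consecutive_def by blast
      have "Max {a..b} = b" using ab(2) by (intro Max_eqI) auto
      then show ?thesis using that ab jB by (auto simp: ext_block_def)
    qed
    ultimately show "\<exists>B\<in>blocks J. j \<in> ext_block B \<and> l \<in> ext_block B" by blast
  qed
  then show ?thesis unfolding pos_roots_def by auto
qed

lemma generator_range: "k \<in> A \<Longrightarrow> A \<subseteq> {1..N - 1} \<Longrightarrow> 1 \<le> k \<and> k < N" for k :: nat
  by (drule (1) subsetD[rotated]) auto

lemma pos_roots_range: "pos_roots N J \<subseteq> {1..N} \<times> {1..N}"
  by (auto simp: pos_roots_def)

lemma finite_pos_roots: "finite (pos_roots N J)"
  by (rule finite_subset[OF pos_roots_range]) simp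

text \<open>A simple reflection permutes the positive roots other than its own. If k is outside J
  and not adjacent to it, every root is even fixed; one formula covers both cases.\<close>

lemma pos_roots_swap:
  assumes J: "J \<subseteq> {1..N - 1}" and k: "k \<in> J \<or> k \<in> {1..N - 1} \<and> k \<notin> J \<and> k - 1 \<notin> J \<and> Suc k \<notin> J"
  shows "bij_betw (map_prod (transpose k (Suc k)) (transpose k (Suc k)))
    (pos_roots N J - {(k, Suc k)}) (pos_roots N J - {(k, Suc k)})"
proof -
  let ?s = "transpose k (Suc k)" and ?R = "pos_roots N J - {(k, Suc k)}"
  have kN: "1 \<le> k" "k < N" using k generator_range[OF _ J] by auto
  have *: "(?s j, ?s l) \<in> ?R" if "(j, l) \<in> ?R" for j l
  proof -
    have jl: "1 \<le> j" "j < l" "l \<le> N" "{j..<l} \<subseteq> J" "j \<noteq> k \<or> l \<noteq> Suc k"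
      using that by (auto simp: pos_roots_iff[OF J])
    have endpoints: "j \<in> J" "l - 1 \<in> J" using jl by auto
    show ?thesis
    proof (cases "k \<in> J")
      case False
      then have "k \<notin> J" "k - 1 \<notin> J" "Suc k \<notin> J" using k by auto
      then have "j \<noteq> k" "j \<noteq> Suc k" "l \<noteq> k" "l \<noteq> Suc k" using endpoints by auto
      then show ?thesis using that by simp
    next
      case True
      \<comment> \<open>Swapping an endpoint can enlarge the interval only by k, which lies in
        J.\<close>
      have sub: "{?s j..<?s l} \<subseteq> insert k {j..<l}" and "?s j < ?s l"
        using jl by (auto simp: transpose_def)
      then have "(?s j, ?s l) \<in> pos_roots N J"
        using True jl kN unfolding pos_roots_iff[OF J] by (auto simp: transpose_def)
      moreover have "(?s j, ?s l) \<noteq> (k, Suc k)" using jl by (auto simp: transpose_def split: if_splits)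
      ultimately show ?thesis by blast
    qed
  qed
  show ?thesis
    by (rule bij_betw_byWitness[of _ "map_prod ?s ?s"]) (use * in auto)
qed

text \<open>A function on which W transforms by det_J; evaluating it at suitable points controls the
  signs.\<close>

definition vandermonde :: "nat \<Rightarrow> nat set \<Rightarrow> (nat \<Rightarrow> real) \<Rightarrow> real" where
  "vandermonde N J x = (\<Prod>(j, l)\<in>pos_roots N J. x j - x l)"

lemma vandermonde_swap:
  assumes J: "J \<subseteq> {1..N - 1}" and k: "k \<in> J \<or> k \<in> {1..N - 1} \<and> k \<notin> J \<and> k - 1 \<notin> J \<and> Suc k \<notin> J"
  shows "vandermonde N J (x \<circ> transpose k (Suc k)) = (if k \<in> J then - 1 else 1) * vandermonde N J x"
proof -
  let ?s = "transpose k (Suc k)" and ?R = "pos_roots N J - {(k, Suc k)}"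
  have R: "(\<Prod>(j, l)\<in>?R. x (?s j) - x (?s l)) = (\<Prod>(j, l)\<in>?R. x j - x l)"
    using prod.reindex_bij_betw[OF pos_roots_swap[OF J k], of "\<lambda>(j, l). x j - x l"]
    by (simp add: case_prod_unfold)
  show ?thesis
  proof (cases "k \<in> J")
    case True
    then have "(k, Suc k) \<in> pos_roots N J"
      using generator_range[OF True J] by (subst pos_roots_iff[OF J]) auto
    then have V: "vandermonde N J y = (y k - y (Suc k)) * (\<Prod>(j, l)\<in>?R. y j - y l)" for y
      unfolding vandermonde_def by (subst prod.remove[OF finite_pos_roots]) auto
    have "vandermonde N J (x \<circ> ?s) = (x (Suc k) - x k) * (\<Prod>(j, l)\<in>?R. x j - x l)"
      unfolding V[of "x \<circ> ?s"] R[symmetric] by simp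
    then show ?thesis using True unfolding V[of x] by (simp add: minus_mult_left)
  next
    case False
    then have "(k, Suc k) \<notin> pos_roots N J" by (subst pos_roots_iff[OF J]) auto
    with R False show ?thesis by (simp add: vandermonde_def)
  qed
qed

lemma vandermonde_nonzero:
  assumes "\<And>j l. (j, l) \<in> pos_roots N J \<Longrightarrow> x j \<noteq> x l"
  shows "vandermonde N J x \<noteq> 0"
  using assms by (auto simp: vandermonde_def finite_pos_roots)

section \<open>Words in the generators and products of root operators\<close>

lemma word_perm_Nil: "word_perm [] = id"
  and word_perm_Cons: "word_perm (k # ks) = transpose k (Suc k) \<circ> word_perm ks"
  by (simp_all add: word_perm_def)

lemma word_perm_append: "word_perm (ks @ ls) = word_perm ks \<circ> word_perm ls"
  by (induction ks) (simp_all add: word_perm_def o_assoc)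

lemma inv_word_perm: "inv (word_perm ks) = word_perm (rev ks)"
proof -
  have "word_perm ls (word_perm (rev ls) x) = x" for ls x
  proof (induction ls arbitrary: x)
    case (Cons k ls)
    have "word_perm [k] y = transpose k (Suc k) y" for y by (simp add: word_perm_def)
    then show ?case by (simp add: word_perm_append word_perm_Cons Cons)
  qed (simp add: word_perm_Nil)
  from this[of ks] this[of "rev ks"] show ?thesis by (intro inv_unique_comp) auto
qed

lemma word_perm_permutes: "set ks \<subseteq> {1..N - 1} \<Longrightarrow> word_perm ks permutes {1..N}"
proof (induction ks)
  case (Cons k ks)
  then have "transpose k (Suc k) permutes {1..N}" by (intro permutes_swap_id) auto
  with Cons show ?case unfolding word_perm_Cons by (intro permutes_compose) auto
qed (simp add: permutes_id word_perm_Nil)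

lemma O_prod_Nil [simp]: "O_prod \<alpha> N [] f = f"
  and O_prod_Cons: "O_prod \<alpha> N (\<beta> # \<beta>s) f = D_root \<alpha> N \<beta> (O_prod \<alpha> N \<beta>s f) + Const (1 / \<alpha>) * O_prod \<alpha> N \<beta>s f"
  by (simp_all add: O_prod_def)

lemma lin_D_root: "lin (D_root \<alpha> N \<beta>)"
  unfolding D_root_def by (cases \<beta>) (auto intro!: lin_intros)

lemma lin_O_prod: "lin (O_prod \<alpha> N \<beta>s)"
proof (induction \<beta>s)
  case Nil
  then show ?case by (simp add: lin_def)
next
  case (Cons \<beta> \<beta>s)
  have "lin (\<lambda>f. D_root \<alpha> N \<beta> (O_prod \<alpha> N \<beta>s f) + Const (1 / \<alpha>) * O_prod \<alpha> N \<beta>s f)"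
    by (intro lin_plus lin_mult lin_comp[OF lin_D_root] Cons)
  then show ?case by (simp add: O_prod_Cons[abs_def])
qed

text \<open>The eigenvalue of one factor of O_J on E_\<mu>. For \<mu> = \<eta> the product over the
  roots is the constant of the theorem.\<close>

definition root_factor :: "real \<Rightarrow> nat \<Rightarrow> comp \<Rightarrow> nat \<times> nat \<Rightarrow> real" where
  "root_factor \<alpha> N \<mu> = (\<lambda>(j, l). (eta_bar \<alpha> N \<mu> j - eta_bar \<alpha> N \<mu> l + 1) / \<alpha>)"

text \<open>The hypotheses are bundled because they are instantiated twice, once for (I, J) and once
  for the fully symmetric pair with I \<union> J and the empty set.\<close>

locale symmetry_data =
  fixes \<alpha> :: real and N :: nat and I J :: "nat set" and \<eta> :: comp
  assumes \<alpha>: "\<alpha> > 0" and I: "I \<subseteq> {1..N - 1}" and J: "J \<subseteq> {1..N - 1}" and disjoint: "I \<inter> J = {}"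
    and nonadjacent: "\<And>i. i \<in> I \<Longrightarrow> i - 1 \<notin> J \<and> Suc i \<notin> J"
    and comp_\<eta>: "composition N \<eta>"
    and dom_I: "\<And>i. i \<in> I \<Longrightarrow> look \<eta> (Suc i) \<le> look \<eta> i"
    and dom_J: "\<And>j. j \<in> J \<Longrightarrow> look \<eta> (Suc j) < look \<eta> j"
begin

abbreviation (input) E :: "comp \<Rightarrow> mpol" where "E \<equiv> nonsym_jack \<alpha> N"

abbreviation (input) s :: "nat \<Rightarrow> nat \<Rightarrow> nat" where "s k \<equiv> transpose k (Suc k)"

text \<open>The value of \<open>det\<^sub>J\<close> at the generator \<open>s\<^sub>k\<close>.\<close>

definition chi :: "nat \<Rightarrow> real" where "chi k = (if k \<in> J then - 1 else 1)"

lemma IJ_range: "k \<in> I \<union> J \<Longrightarrow> 1 \<le> k" "k \<in> I \<union> J \<Longrightarrow> k < N"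
  using generator_range[OF _ I] generator_range[OF _ J] by auto

lemma IJ_cases: "k \<in> I \<union> J \<Longrightarrow> k \<in> J \<or> k \<in> {1..N - 1} \<and> k \<notin> J \<and> k - 1 \<notin> J \<and> Suc k \<notin> J"
  using I J disjoint nonadjacent by auto

lemma dom_IJ: "k \<in> I \<union> J \<Longrightarrow> look \<eta> (Suc k) \<le> look \<eta> k"
  using dom_I dom_J less_imp_le by blast

lemma W_permutes: "w \<in> W (I \<union> J) \<Longrightarrow> w permutes {1..N}"
  using I J unfolding W_def
  by (elim imageE) (hypsubst, rule word_perm_permutes, auto simp: in_lists_conv_set)

lemma W_bij: "w \<in> W (I \<union> J) \<Longrightarrow> bij w"
  using W_permutes permutes_bij by blast

lemma finite_W: "finite (W (I \<union> J))"
  by (rule finite_subset[OF _ finite_permutations[of "{1..N}"]]) (use W_permutes in auto)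

lemma W_id: "id \<in> W (I \<union> J)"
  unfolding W_def by (rule image_eqI[of _ _ "[]"]) (auto simp: word_perm_Nil)

lemma W_gen: "k \<in> I \<union> J \<Longrightarrow> s k \<in> W (I \<union> J)"
  unfolding W_def by (rule image_eqI[of _ _ "[k]"]) (auto simp: word_perm_def)

lemma W_comp: "v \<in> W (I \<union> J) \<Longrightarrow> w \<in> W (I \<union> J) \<Longrightarrow> v \<circ> w \<in> W (I \<union> J)"
  unfolding W_def by (elim imageE) (simp flip: word_perm_append)

lemma W_inv: "w \<in> W (I \<union> J) \<Longrightarrow> inv w \<in> W (I \<union> J)"
  unfolding W_def by (elim imageE) (simp add: inv_word_perm in_lists_conv_set)

lemma W_induct [consumes 1, case_names id step]:
  assumes "w \<in> W (I \<union> J)" "P id" "\<And>k w. k \<in> I \<union> J \<Longrightarrow> w \<in> W (I \<union> J) \<Longrightarrow> P w \<Longrightarrow> P (s k \<circ> w)"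
  shows "P w"
proof -
  have "P (word_perm ks)" if "ks \<in> lists (I \<union> J)" for ks
    using that
  proof (induction ks)
    case (Cons k ks)
    then show ?case unfolding word_perm_Cons by (intro assms(3)) (auto simp: W_def)
  qed (simp only: word_perm_Nil assms(2))
  then show ?thesis using assms(1) by (auto simp: W_def)
qed

lemma vandermonde_word:
  "ks \<in> lists (I \<union> J) \<Longrightarrow> vandermonde N J (x \<circ> word_perm ks) = (- 1) ^ length (filter (\<lambda>k. k \<in> J) ks) * vandermonde N J x"
proof (induction ks arbitrary: x)
  case (Cons k ks)
  then have k: "k \<in> I \<union> J" by simp
  have "vandermonde N J (x \<circ> word_perm (k # ks)) = vandermonde N J ((x \<circ> s k) \<circ> word_perm ks)"
    by (simp only: word_perm_Cons o_assoc)
  also have "\<dots> = (- 1) ^ length (filter (\<lambda>k. k \<in> J) ks) * vandermonde N J (x \<circ> s k)"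
    using Cons.prems by (intro Cons.IH) simp
  also have "\<dots> = (- 1) ^ length (filter (\<lambda>k. k \<in> J) (k # ks)) * vandermonde N J x"
    unfolding vandermonde_swap[OF J IJ_cases[OF k]] by simp
  finally show ?case .
qed (simp add: word_perm_Nil)

text \<open>Evaluating at a point where the partial Vandermonde product does not vanish shows that the
  parity of the number of letters from \<open>J\<close> depends on the permutation only.\<close>

lemma det_sign_word:
  assumes ks: "ks \<in> lists (I \<union> J)"
  shows "det_sign I J (word_perm ks) = (- 1) ^ length (filter (\<lambda>k. k \<in> J) ks)"
proof -
  have nz: "vandermonde N J real \<noteq> 0" by (rule vandermonde_nonzero) (auto simp: pos_roots_def)
  let ?n = "\<lambda>ks. length (filter (\<lambda>k. k \<in> J) ks)"
  have "even (?n ks) \<longleftrightarrow> even (?n ls)" if "ls \<in> lists (I \<union> J)" "word_perm ks = word_perm ls" for ls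
  proof -
    have "(- 1) ^ ?n ks * vandermonde N J real = (- 1) ^ ?n ls * vandermonde N J real"
      using vandermonde_word[OF ks, of real] vandermonde_word[OF that(1), of real] that(2) by metis
    then have "(- 1 :: real) ^ ?n ks = (- 1) ^ ?n ls" using nz by simp
    then show ?thesis by (simp add: minus_one_power_iff split: if_splits)
  qed
  then have "(\<exists>ls\<in>lists (I \<union> J). word_perm ks = word_perm ls \<and> even (?n ls)) \<longleftrightarrow> even (?n ks)"
    using ks by metis
  then show ?thesis by (simp add: det_sign_def minus_one_power_iff)
qed

lemma det_sign_comp:
  "v \<in> W (I \<union> J) \<Longrightarrow> w \<in> W (I \<union> J) \<Longrightarrow> det_sign I J (v \<circ> w) = det_sign I J v * det_sign I J w"
  unfolding W_def
  by (elim imageE) (simp add: det_sign_word power_add flip: word_perm_append)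

lemma det_sign_gen: "k \<in> I \<union> J \<Longrightarrow> det_sign I J (s k) = chi k"
  using det_sign_word[of "[k]"] by (simp add: chi_def word_perm_Cons word_perm_Nil)

lemma det_sign_nonzero: "det_sign I J w \<noteq> 0"
  by (simp add: det_sign_def)

lemma det_sign_vandermonde: "w \<in> W (I \<union> J) \<Longrightarrow> vandermonde N J (x \<circ> w) = det_sign I J w * vandermonde N J x"
  unfolding W_def by (elim imageE) (simp add: vandermonde_word det_sign_word)

text \<open>Evaluate \<open>vandermonde\<close> at the entries of \<eta>: strict descent along J
  makes the value nonzero, and w leaves the entries unchanged.\<close>

lemma det_sign_stabilizer:
  assumes w: "w \<in> W (I \<union> J)" and stab: "perm_comp w \<eta> = \<eta>"
  shows "det_sign I J w = 1"
proof -
  have "look \<eta> l < look \<eta> j" if "j < l" "{j..<l} \<subseteq> J" for j l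
    using that
  proof (induction l)
    case (Suc l)
    then have "l \<in> J" by auto
    then show ?case
      using Suc dom_J[of l] by (cases "j = l") (auto intro: less_trans simp: atLeastLessThanSuc)
  qed simp
  then have nz: "vandermonde N J (real \<circ> look \<eta>) \<noteq> 0"
    by (intro vandermonde_nonzero) (force simp: pos_roots_iff[OF J])
  have "look \<eta> (w i) = look \<eta> i" for i
    using look_perm_comp[OF W_bij[OF w], of \<eta> "w i"] stab W_bij[OF w] by (simp add: bij_is_inj)
  then have "(real \<circ> look \<eta>) \<circ> w = real \<circ> look \<eta>" by auto
  then show ?thesis using det_sign_vandermonde[OF w, of "real \<circ> look \<eta>"] nz by simp
qed

lemma sym_op_eq: "sym_op I J f = (\<Sum>w\<in>W (I \<union> J). Const (det_sign I J w) * act w f)"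
  by (rule lin_eqI[of "sym_op I J" "\<lambda>f. \<Sum>w\<in>W (I \<union> J). Const (det_sign I J w) * act w f" f])
    (auto intro!: lin_intros simp: sym_op_def lin_lin_ext act_monom)

lemma lin_sym_op: "lin (sym_op I J)"
  by (simp add: sym_op_def lin_lin_ext)

lemma chi_square: "chi k * chi k = 1"
  by (simp add: chi_def)

text \<open>Left translation by the generator permutes the group; right translation does the same in
  the next lemma.\<close>

lemma act_sym_op:
  assumes k: "k \<in> I \<union> J"
  shows "act (s k) (sym_op I J f) = Const (chi k) * sym_op I J f"
proof -
  have bij: "bij_betw ((\<circ>) (s k)) (W (I \<union> J)) (W (I \<union> J))"
    by (rule bij_betw_byWitness[of _ "(\<circ>) (s k)"]) (auto simp: o_assoc W_comp W_gen[OF k])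
  have "Const (chi k) * sym_op I J f = (\<Sum>w\<in>W (I \<union> J). Const (chi k * det_sign I J w) * act w f)"
    by (simp add: sym_op_eq sum_distrib_left)
  also have "\<dots> = (\<Sum>w\<in>W (I \<union> J). Const (chi k * det_sign I J (s k \<circ> w)) * act (s k \<circ> w) f)"
    by (rule sum.reindex_bij_betw[OF bij, symmetric])
  also have "\<dots> = (\<Sum>w\<in>W (I \<union> J). Const (det_sign I J w) * act (s k) (act w f))"
    using k by (intro sum.cong)
      (simp_all add: det_sign_comp W_gen det_sign_gen chi_square act_comp W_bij mult.assoc[symmetric])
  finally show ?thesis by (simp add: sym_op_eq)
qed

lemma sym_op_act:
  assumes k: "k \<in> I \<union> J"
  shows "sym_op I J (act (s k) f) = Const (chi k) * sym_op I J f"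
proof -
  have bij: "bij_betw (\<lambda>w. w \<circ> s k) (W (I \<union> J)) (W (I \<union> J))"
    by (rule bij_betw_byWitness[of _ "\<lambda>w. w \<circ> s k"]) (auto simp: comp_assoc W_comp W_gen[OF k])
  have "Const (chi k) * sym_op I J f = (\<Sum>w\<in>W (I \<union> J). Const (chi k * det_sign I J w) * act w f)"
    by (simp add: sym_op_eq sum_distrib_left)
  also have "\<dots> = (\<Sum>w\<in>W (I \<union> J). Const (chi k * det_sign I J (w \<circ> s k)) * act (w \<circ> s k) f)"
    by (rule sum.reindex_bij_betw[OF bij, symmetric])
  also have "\<dots> = (\<Sum>w\<in>W (I \<union> J). Const (det_sign I J w) * act w (act (s k) f))"
    using k chi_square[of k] by (intro sum.cong)
      (simp_all add: det_sign_comp W_gen det_sign_gen act_comp W_bij mult.left_commute[of "chi k"])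
  finally show ?thesis by (simp add: sym_op_eq)
qed

section \<open>The orbit of \<eta> and the span of its Jack polynomials\<close>

definition orbit :: "comp set" where
  "orbit = (\<lambda>w. perm_comp w \<eta>) ` W (I \<union> J)"

lemma finite_orbit: "finite orbit"
  by (simp add: orbit_def finite_W)

lemma orbit_perm: "w \<in> W (I \<union> J) \<Longrightarrow> \<mu> \<in> orbit \<Longrightarrow> perm_comp w \<mu> \<in> orbit"
  unfolding orbit_def using W_comp by (auto simp: perm_comp_comp W_bij)

lemma orbit_swap: "k \<in> I \<union> J \<Longrightarrow> \<mu> \<in> orbit \<Longrightarrow> perm_comp (s k) \<mu> \<in> orbit"
  by (rule orbit_perm[OF W_gen])

lemma orbit_self: "\<eta> \<in> orbit"
  unfolding orbit_def by (rule image_eqI[OF _ W_id]) simp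

lemma orbit_connected:
  assumes "\<mu> \<in> orbit" "\<nu> \<in> orbit"
  obtains w where "w \<in> W (I \<union> J)" "\<nu> = perm_comp w \<mu>"
proof -
  obtain u v where uv: "u \<in> W (I \<union> J)" "v \<in> W (I \<union> J)" "\<mu> = perm_comp u \<eta>" "\<nu> = perm_comp v \<eta>"
    using assms by (auto simp: orbit_def)
  then have "\<nu> = perm_comp (v \<circ> inv u) \<mu>"
    by (simp add: perm_comp_inv' W_bij W_inv flip: perm_comp_comp)
  then show ?thesis using that uv W_comp W_inv by blast
qed

lemma orbit_composition: "\<mu> \<in> orbit \<Longrightarrow> composition N \<mu>"
  unfolding orbit_def using composition_perm W_permutes comp_\<eta> by blast

text \<open>Since \<eta> descends weakly along every generator, the set of compositions below it is
  stable under each of them.\<close>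

lemma orbit_below: "\<mu> \<in> orbit \<Longrightarrow> below_eq N \<mu> \<eta>"
proof -
  assume "\<mu> \<in> orbit"
  then obtain w where w: "w \<in> W (I \<union> J)" "\<mu> = perm_comp w \<eta>" by (auto simp: orbit_def)
  have "below_eq N (perm_comp w \<eta>) \<eta>"
    using w(1)
  proof (induction rule: W_induct)
    case (step k w)
    then have "below_eq N (perm_comp (s k) (perm_comp w \<eta>)) \<eta>"
      by (intro below_eq_swap_dominant dom_IJ IJ_range comp_\<eta>) auto
    then show ?case using step by (simp only: perm_comp_comp W_bij W_gen)
  qed (simp only: perm_comp_id simp_thms)
  with w show ?thesis by simp
qed

definition V :: "mpol set" where
  "V = mpol.span (E ` orbit)"

lemma V_E: "\<mu> \<in> orbit \<Longrightarrow> E \<mu> \<in> V"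
  unfolding V_def by (rule mpol.span_base) simp

lemma V_scale: "f \<in> V \<Longrightarrow> Const c * f \<in> V"
  and V_add: "f \<in> V \<Longrightarrow> g \<in> V \<Longrightarrow> f + g \<in> V"
  and V_diff: "f \<in> V \<Longrightarrow> g \<in> V \<Longrightarrow> f - g \<in> V"
  by (simp_all add: V_def mpol.span_scale mpol.span_add mpol.span_diff)

text \<open>The clause on ties is kept because eigenvalues are exchanged by s_k only when the two
  entries differ.\<close>

lemma E_swap:
  assumes k: "k \<in> I \<union> J" and \<mu>: "\<mu> \<in> orbit"
  obtains a b where "act (s k) (E \<mu>) = Const a * E \<mu> + Const b * E (perm_comp (s k) \<mu>)"
    "look \<mu> k = look \<mu> (Suc k) \<Longrightarrow> b = 0"
proof -
  note kN = IJ_range[OF k] and c = orbit_composition[OF \<mu>]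
  let ?\<nu> = "perm_comp (s k) \<mu>"
  have c': "composition N ?\<nu>" using orbit_composition[OF orbit_swap[OF k \<mu>]] .
  consider "look \<mu> k = look \<mu> (Suc k)" | "look \<mu> k < look \<mu> (Suc k)" | "look \<mu> (Suc k) < look \<mu> k"
    by linarith
  then show ?thesis
  proof cases
    case 1
    with jack_swap_eq[OF \<alpha> kN 1 c] show ?thesis by (intro that[of 1 0]) auto
  next
    case 2
    with jack_swap_up[OF \<alpha> kN 2 c] show ?thesis
      by (intro that[of "1 / (eta_bar \<alpha> N \<mu> k - eta_bar \<alpha> N \<mu> (Suc k))" 1]) auto
  next
    case 3
    define \<delta> where "\<delta> = eta_bar \<alpha> N ?\<nu> k - eta_bar \<alpha> N ?\<nu> (Suc k)"
    have "look ?\<nu> k < look ?\<nu> (Suc k)" using 3 by (simp add: look_perm_comp)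
    from jack_swap_up[OF \<alpha> kN this c']
    have E: "E \<mu> = act (s k) (E ?\<nu>) - Const (1 / \<delta>) * E ?\<nu>" by (simp add: perm_comp_comp \<delta>_def)
    then have E': "act (s k) (E ?\<nu>) = E \<mu> + Const (1 / \<delta>) * E ?\<nu>" by simp
    \<comment> \<open>As s_k is an involution, the upward formula from \<nu> can be used a second
      time for the image of E_\<nu>.\<close>
    have "act (s k) (E \<mu>) = E ?\<nu> - Const (1 / \<delta>) * act (s k) (E ?\<nu>)" by (subst E) simp
    also have "\<dots> = Const (- (1 / \<delta>)) * E \<mu> + (E ?\<nu> - Const (1 / \<delta>) * (Const (1 / \<delta>) * E ?\<nu>))"
      unfolding E' Const_minus by (simp only: distrib_left mult_minus_left) simp
    also have "E ?\<nu> - Const (1 / \<delta>) * (Const (1 / \<delta>) * E ?\<nu>) = Const (1 - 1 / \<delta> * (1 / \<delta>)) * E ?\<nu>"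
      unfolding Const_diff Const_mult left_diff_distrib by (simp only: Const_1 mult_1_left mult.assoc)
    finally have eq: "act (s k) (E \<mu>) = Const (- (1 / \<delta>)) * E \<mu> + Const (1 - 1 / \<delta> * (1 / \<delta>)) * E ?\<nu>" .
    show ?thesis by (rule that[OF eq]) (use 3 in simp)
  qed
qed

lemma V_swap: "k \<in> I \<union> J \<Longrightarrow> f \<in> V \<Longrightarrow> act (s k) f \<in> V"
  unfolding V_def
proof (rule lin_span_closed[OF lin_act])
  fix x assume k: "k \<in> I \<union> J" and "x \<in> E ` orbit"
  then obtain \<mu> where \<mu>: "\<mu> \<in> orbit" "x = E \<mu>" by blast
  then show "act (s k) x \<in> mpol.span (E ` orbit)"
    using E_swap[OF k \<mu>(1)] V_add V_scale V_E orbit_swap[OF k \<mu>(1)] unfolding V_def by metis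
qed

lemma V_act: "w \<in> W (I \<union> J) \<Longrightarrow> f \<in> V \<Longrightarrow> act w f \<in> V"
  by (induction rule: W_induct) (simp_all add: V_swap W_bij flip: act_comp)

lemma V_sym_op:
  assumes "f \<in> V"
  shows "sym_op I J f \<in> V"
  unfolding sym_op_eq V_def
  by (intro mpol.span_sum mpol.span_scale) (rule V_act[OF _ assms, unfolded V_def])

lemma V_keys:
  assumes "f \<in> V" "\<kappa> \<in> supp f"
  shows "below_eq N \<kappa> \<eta>"
proof -
  have "mpol.subspace {f. \<forall>\<kappa>\<in>supp f. below_eq N \<kappa> \<eta>}"
  proof (rule mpol.subspaceI)
    fix x y :: mpol assume *: "x \<in> {f. \<forall>\<kappa>\<in>supp f. below_eq N \<kappa> \<eta>}" "y \<in> {f. \<forall>\<kappa>\<in>supp f. below_eq N \<kappa> \<eta>}"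
    show "x + y \<in> {f. \<forall>\<kappa>\<in>supp f. below_eq N \<kappa> \<eta>}"
    proof (intro CollectI ballI)
      fix \<kappa> assume "\<kappa> \<in> supp (x + y)"
      then have "\<kappa> \<in> supp x \<union> supp y" using keys_add by (rule subsetD[rotated])
      then show "below_eq N \<kappa> \<eta>" using * by blast
    qed
  qed (simp_all add: in_keys_iff)
  moreover have "E ` orbit \<subseteq> {f. \<forall>\<kappa>\<in>supp f. below_eq N \<kappa> \<eta>}"
    using jack_keys[OF \<alpha> orbit_composition] orbit_below below_trans by blast
  ultimately have "V \<subseteq> {f. \<forall>\<kappa>\<in>supp f. below_eq N \<kappa> \<eta>}"
    unfolding V_def by (intro mpol.span_minimal)
  with assms show ?thesis by blast
qed

text \<open>Going up the orbit multiplies \<open>sym_op I J (E \<mu>)\<close> by \<open>chi k - 1/\<delta>\<close> with \<open>\<delta> < -1\<close>; at the bottom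
  the only monomial of \<open>E \<mu>\<close> from the orbit is \<open>z\<^sup>\<mu>\<close>, so no cancellation is possible.\<close>

lemma sym_op_jack_nonzero:
  "\<mu> \<in> orbit \<Longrightarrow> look (sym_op I J (E \<mu>)) \<eta> \<noteq> 0"
proof (induction "\<Sum>j=1..N. (N - j) * look \<mu> j" arbitrary: \<mu> rule: less_induct)
  case less
  note c = orbit_composition[OF less.prems]
  show ?case
  proof (cases "\<exists>k\<in>I \<union> J. look \<mu> (Suc k) < look \<mu> k")
    case True
    then obtain k where k: "k \<in> I \<union> J" and gt: "look \<mu> (Suc k) < look \<mu> k" by blast
    note kN = IJ_range[OF k]
    let ?\<nu> = "perm_comp (s k) \<mu>"
    define \<delta> where "\<delta> = eta_bar \<alpha> N ?\<nu> k - eta_bar \<alpha> N ?\<nu> (Suc k)"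
    have lt: "look ?\<nu> k < look ?\<nu> (Suc k)" using gt by (simp add: look_perm_comp)
    have \<nu>: "?\<nu> \<in> orbit" by (rule orbit_swap[OF k less.prems])
    have "E \<mu> = act (s k) (E ?\<nu>) - Const (1 / \<delta>) * E ?\<nu>"
      using jack_swap_up[OF \<alpha> kN lt orbit_composition[OF \<nu>]] by (simp add: perm_comp_comp \<delta>_def)
    then have "look (sym_op I J (E \<mu>)) \<eta> = (chi k - 1 / \<delta>) * look (sym_op I J (E ?\<nu>)) \<eta>"
      by (simp add: lin_diff[OF lin_sym_op] lin_scale[OF lin_sym_op] sym_op_act[OF k] lookup_minus left_diff_distrib)
    moreover have "look (sym_op I J (E ?\<nu>)) \<eta> \<noteq> 0"
      by (rule less.hyps[OF swap_measure[OF kN gt] \<nu>])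
    moreover have "\<delta> < - 1" using eta_bar_swap_bound[OF \<alpha> kN lt] by (simp add: \<delta>_def)
    then have "chi k - 1 / \<delta> \<noteq> 0" by (auto simp: chi_def field_simps)
    ultimately show ?thesis by simp
  next
    case False
    have up: "below_eq N \<mu> \<nu>" if "\<nu> \<in> orbit" for \<nu>
    proof -
      obtain w where w: "w \<in> W (I \<union> J)" "\<nu> = perm_comp w \<mu>" using orbit_connected[OF less.prems \<open>\<nu> \<in> orbit\<close>] .
      have "below_eq N \<mu> (perm_comp w \<mu>)" using w(1)
      proof (induction rule: W_induct)
        case (step k w)
        then have "below_eq N \<mu> (perm_comp (s k) (perm_comp w \<mu>))"
          using False by (intro below_eq_swap_antidominant entries_perm W_permutes IJ_range c) (auto simp: not_less)
        then show ?case using step by (simp only: perm_comp_comp W_bij W_gen)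
      qed (simp only: perm_comp_id simp_thms)
      with w show ?thesis by simp
    qed
    have coef: "look (E \<mu>) \<nu> = (if \<nu> = \<mu> then 1 else 0)" if "\<nu> \<in> orbit" for \<nu>
      using look_jack[OF \<alpha> c] jack_keys[OF \<alpha> c, of \<nu>] below_antisym[OF up[OF that]] by (auto simp: in_keys_iff)
    \<comment> \<open>The group elements that carry z^\<mu> to z^\<eta>. Any two differ by an
      element of the stabilizer of \<eta>, where det_J is 1, so their contributions have a common
      sign.\<close>
    let ?S = "{w\<in>W (I \<union> J). perm_comp (inv w) \<eta> = \<mu>}"
    obtain v where v: "v \<in> W (I \<union> J)" "\<mu> = perm_comp v \<eta>" using less.prems by (auto simp: orbit_def)
    have v': "inv v \<in> ?S" using v by (simp add: W_inv inv_inv_eq W_bij)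
    have S: "det_sign I J w = det_sign I J (inv v)" if "w \<in> ?S" for w
    proof -
      have w: "w \<in> W (I \<union> J)" "perm_comp (inv w) \<eta> = \<mu>" using that by auto
      have "perm_comp (inv v \<circ> inv w) \<eta> = perm_comp (inv v) (perm_comp v \<eta>)"
        using w v by (simp add: W_bij W_inv flip: perm_comp_comp)
      also have "\<dots> = \<eta>" using v by (simp add: perm_comp_inv' W_bij)
      finally have "det_sign I J (inv v \<circ> inv w) = 1"
        using w v by (intro det_sign_stabilizer W_comp W_inv)
      then have "det_sign I J (inv v) * det_sign I J (inv w) = 1" using w v by (simp add: det_sign_comp W_inv)
      moreover have "det_sign I J (inv w) * det_sign I J w = 1"
        using w det_sign_comp[of "inv w" w] det_sign_word[of "[]"]
        by (simp add: word_perm_Nil W_inv bij_is_inj W_bij)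
      ultimately show ?thesis by (metis mult.commute mult.left_commute mult.right_neutral)
    qed
    have "look (sym_op I J (E \<mu>)) \<eta> = (\<Sum>w\<in>W (I \<union> J). if perm_comp (inv w) \<eta> = \<mu> then det_sign I J w else 0)"
      unfolding sym_op_eq look_sum
      using orbit_perm[OF W_inv orbit_self] by (intro sum.cong) (auto simp: look_act W_bij coef)
    also have "\<dots> = (\<Sum>w\<in>?S. det_sign I J w)"
      by (simp add: sum.inter_filter finite_W)
    also have "\<dots> = real (card ?S) * det_sign I J (inv v)"
      using S by simp
    finally show ?thesis
      using v' finite_W det_sign_nonzero by (auto simp: card_eq_0_iff)
  qed
qed

lemma V_expand:
  assumes "f \<in> V"
  obtains b where "f = (\<Sum>\<mu>\<in>orbit. Const (b \<mu>) * E \<mu>)"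
proof -
  let ?T = "{f. \<exists>b. f = (\<Sum>\<mu>\<in>orbit. Const (b \<mu>) * E \<mu>)}"
  have "mpol.subspace ?T"
  proof (rule mpol.subspaceI)
    show "0 \<in> ?T" by (auto intro!: exI[of _ "\<lambda>_. 0"])
    show "f + g \<in> ?T" if fg: "f \<in> ?T" "g \<in> ?T" for f g
    proof -
      obtain b where b: "f = (\<Sum>\<mu>\<in>orbit. Const (b \<mu>) * E \<mu>)" using fg(1) by blast
      obtain c where c: "g = (\<Sum>\<mu>\<in>orbit. Const (c \<mu>) * E \<mu>)" using fg(2) by blast
      note bc = b c
      show ?thesis unfolding bc
        by (auto intro!: exI[of _ "\<lambda>\<mu>. b \<mu> + c \<mu>"] simp: Const_add distrib_right sum.distrib)
    qed
    show "Const c * f \<in> ?T" if f: "f \<in> ?T" for c f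
    proof -
      obtain b where b: "f = (\<Sum>\<mu>\<in>orbit. Const (b \<mu>) * E \<mu>)" using f by blast
      show ?thesis unfolding b by (auto intro!: exI[of _ "\<lambda>\<mu>. c * b \<mu>"] simp: sum_distrib_left)
    qed
  qed
  moreover have "E \<mu> \<in> ?T" if "\<mu> \<in> orbit" for \<mu>
    using that finite_orbit
    by (auto intro!: exI[of _ "\<lambda>\<nu>. if \<nu> = \<mu> then 1 else 0"] simp: if_distrib[of Const] if_distrib[of "\<lambda>x. x * _"] cong: if_cong)
  ultimately have "V \<subseteq> ?T" unfolding V_def by (intro mpol.span_minimal) auto
  then have "f \<in> ?T" using assms by blast
  then show ?thesis using that by auto
qed

text \<open>A maximal \<mu> in the expansion of g gives a nonzero coefficient of z^\<mu>. Some group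
  element moves \<mu> to \<eta> and multiplies g by a scalar, which relates this coefficient to the
  one at \<eta>.\<close>

lemma V_eq_0:
  assumes g: "g \<in> V" and e: "\<And>k. k \<in> I \<union> J \<Longrightarrow> act (s k) g = Const (e k) * g" and 0: "look g \<eta> = 0"
  shows "g = 0"
proof (rule ccontr)
  assume "g \<noteq> 0"
  obtain b where b: "g = (\<Sum>\<mu>\<in>orbit. Const (b \<mu>) * E \<mu>)" by (rule V_expand[OF g])
  let ?A = "{\<mu>\<in>orbit. b \<mu> \<noteq> 0}"
  have "?A \<noteq> {}"
  proof
    assume "?A = {}"
    then have "g = 0" unfolding b by (intro sum.neutral) auto
    with \<open>g \<noteq> 0\<close> show False ..
  qed
  then obtain \<kappa> where \<kappa>: "\<kappa> \<in> ?A" by blast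
  have fin: "finite ?A" using finite_orbit by simp
  obtain \<mu> where \<mu>: "\<mu> \<in> ?A" and max: "\<And>\<nu>. \<nu> \<in> ?A \<Longrightarrow> \<not> below N \<mu> \<nu>"
    using ex_maximal_above[OF fin \<kappa>, of N] by blast
  have coef: "b \<nu> * look (E \<nu>) \<mu> = (if \<nu> = \<mu> then b \<mu> else 0)" if \<nu>: "\<nu> \<in> orbit" for \<nu>
  proof (cases "\<nu> = \<mu> \<or> b \<nu> = 0")
    case True
    then show ?thesis using look_jack[OF \<alpha> orbit_composition[OF \<nu>]] by auto
  next
    case False
    then have "\<not> below_eq N \<mu> \<nu>" using max[of \<nu>] \<nu> by auto
    then have "\<mu> \<notin> supp (E \<nu>)" using jack_keys[OF \<alpha> orbit_composition[OF \<nu>]] by blast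
    with False show ?thesis by (simp add: in_keys_iff)
  qed
  have "look g \<mu> = (\<Sum>\<nu>\<in>orbit. if \<nu> = \<mu> then b \<mu> else 0)"
    unfolding b look_sum by (intro sum.cong) (simp_all add: coef)
  then have "look g \<mu> = b \<mu>" using \<mu> finite_orbit by simp
  then have nz: "look g \<mu> \<noteq> 0" using \<mu> by simp
  have "\<exists>c. act w g = Const c * g" if "w \<in> W (I \<union> J)" for w
    using that
  proof (induction rule: W_induct)
    case id
    show ?case by (rule exI[of _ 1]) (simp only: act_id Const_1 mult_1_left)
  next
    case (step k w)
    then obtain c where "act w g = Const c * g" by blast
    then have "act (s k \<circ> w) g = Const (c * e k) * g"
      using step e by (simp add: W_bij flip: act_comp)
    then show ?case by (rule exI)
  qed
  moreover obtain w where w: "w \<in> W (I \<union> J)" "\<mu> = perm_comp w \<eta>" using \<mu> by (auto simp: orbit_def)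
  ultimately obtain c where "act (inv w) g = Const c * g" using W_inv by blast
  then have "look (act (inv w) g) \<eta> = 0" using 0 by simp
  then have "look g \<mu> = 0" using w by (simp add: look_act W_bij W_inv inv_inv_eq)
  with nz show False ..
qed

text \<open>The nonzero leading coefficient makes the normalization possible and unique; the
  expansion in V supplies triangularity.\<close>

lemma jack_prescribed:
  defines "F \<equiv> jack_prescribed \<alpha> N I J \<eta>"
  shows jack_prescribed_V: "F \<in> V" and jack_prescribed_look: "look F \<eta> = 1"
    and jack_prescribed_act: "k \<in> I \<union> J \<Longrightarrow> act (s k) F = Const (chi k) * F"
proof -
  define a where "a = look (sym_op I J (E \<eta>)) \<eta>"
  define F' where "F' = Const (1 / a) * sym_op I J (E \<eta>)"
  have a: "a \<noteq> 0" unfolding a_def by (rule sym_op_jack_nonzero[OF orbit_self])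
  have V: "F' \<in> V" unfolding F'_def by (intro V_scale V_sym_op V_E orbit_self)
  have L: "look F' \<eta> = 1" using a by (simp add: F'_def a_def)
  have "F = F'"
    unfolding F_def jack_prescribed_def
  proof (rule the_equality)
    show "(\<exists>a. F' = Const a * sym_op I J (nonsym_jack \<alpha> N \<eta>)) \<and> unitriangular N \<eta> F'"
      using L V_keys[OF V] below_prec unfolding unitriangular_def by (auto simp: F'_def)
  next
    fix f assume "(\<exists>b. f = Const b * sym_op I J (nonsym_jack \<alpha> N \<eta>)) \<and> unitriangular N \<eta> f"
    then obtain b where b: "f = Const b * sym_op I J (E \<eta>)" "look f \<eta> = 1" unfolding unitriangular_def by blast
    then have "b = 1 / a" using a by (simp add: a_def field_simps)
    then show "f = F'" by (simp add: b F'_def)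
  qed
  then show "F \<in> V" "look F \<eta> = 1" "k \<in> I \<union> J \<Longrightarrow> act (s k) F = Const (chi k) * F"
    using V L by (simp_all add: F'_def act_sym_op mult.left_commute)
qed

text \<open>The scalar is a product over the set of roots, so on Jack polynomials the order of the
  list disappears.\<close>

lemma O_prod_jack:
  assumes "set \<beta>s \<subseteq> {1..N} \<times> {1..N}" "distinct \<beta>s" and c: "composition N \<mu>"
  shows "O_prod \<alpha> N \<beta>s (E \<mu>) = Const (\<Prod>\<beta>\<in>set \<beta>s. root_factor \<alpha> N \<mu> \<beta>) * E \<mu>"
  using assms(1,2)
proof (induction \<beta>s)
  case (Cons \<beta> \<beta>s)
  obtain j l where \<beta>: "\<beta> = (j, l)" by (cases \<beta>)
  have jl: "j \<in> {1..N}" "l \<in> {1..N}" using Cons.prems by (auto simp: \<beta>)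
  have ev: "cherednik \<alpha> N i (E \<mu>) = Const (eta_bar \<alpha> N \<mu> i) * E \<mu>" if "i \<in> {1..N}" for i
    using eigen_jack[OF \<alpha> c] that by (simp add: eigen_def)
  have D: "D_root \<alpha> N \<beta> (E \<mu>) + Const (1 / \<alpha>) * E \<mu> = Const (root_factor \<alpha> N \<mu> \<beta>) * E \<mu>"
    using ev[OF jl(1)] ev[OF jl(2)]
    by (simp add: \<beta> D_root_def root_factor_def add_divide_distrib diff_divide_distrib right_diff_distrib
        Const_add Const_diff distrib_right left_diff_distrib)
  let ?p = "\<Prod>\<beta>\<in>set \<beta>s. root_factor \<alpha> N \<mu> \<beta>"
  have "O_prod \<alpha> N (\<beta> # \<beta>s) (E \<mu>) = Const ?p * (D_root \<alpha> N \<beta> (E \<mu>) + Const (1 / \<alpha>) * E \<mu>)"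
    using Cons by (simp only: O_prod_Cons lin_scale[OF lin_D_root] distrib_left mult.left_commute[of "Const (1 / \<alpha>)"]
        distinct.simps set_simps insert_subset simp_thms)
  also have "\<dots> = Const (\<Prod>\<beta>\<in>set (\<beta> # \<beta>s). root_factor \<alpha> N \<mu> \<beta>) * E \<mu>"
    unfolding D using Cons.prems by (simp add: mult.commute[of "root_factor \<alpha> N \<mu> \<beta>" ?p])
  finally show ?case .
qed simp

lemma V_O_prod:
  assumes "set \<beta>s \<subseteq> {1..N} \<times> {1..N}" "distinct \<beta>s" "f \<in> V"
  shows "O_prod \<alpha> N \<beta>s f \<in> V"
  using assms(3) unfolding V_def
proof (rule lin_span_closed[OF lin_O_prod, rotated])
  fix x assume "x \<in> E ` orbit"
  then obtain \<mu> where \<mu>: "\<mu> \<in> orbit" "x = E \<mu>" by blast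
  then show "O_prod \<alpha> N \<beta>s x \<in> mpol.span (E ` orbit)"
    unfolding \<mu>(2) O_prod_jack[OF assms(1,2) orbit_composition[OF \<mu>(1)]]
    by (intro mpol.span_scale mpol.span_base imageI)
qed

lemma O_prod_swap:
  assumes k: "k \<in> I \<union> J" and \<beta>s: "set \<beta>s \<subseteq> {1..N} \<times> {1..N}" "distinct \<beta>s"
    and bij: "bij_betw (map_prod (s k) (s k)) (set \<beta>s) (set \<beta>s)" and f: "f \<in> V"
  shows "O_prod \<alpha> N \<beta>s (act (s k) f) = act (s k) (O_prod \<alpha> N \<beta>s f)"
proof (rule lin_eq_on_span[of "\<lambda>f. O_prod \<alpha> N \<beta>s (act (s k) f)" "\<lambda>f. act (s k) (O_prod \<alpha> N \<beta>s f)" "E ` orbit" f])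
  fix x assume "x \<in> E ` orbit"
  then obtain \<mu> where \<mu>: "\<mu> \<in> orbit" "x = E \<mu>" by blast
  let ?\<nu> = "perm_comp (s k) \<mu>" and ?p = "\<lambda>\<mu>. \<Prod>\<beta>\<in>set \<beta>s. root_factor \<alpha> N \<mu> \<beta>"
  obtain a b where ab: "act (s k) (E \<mu>) = Const a * E \<mu> + Const b * E ?\<nu>" "look \<mu> k = look \<mu> (Suc k) \<Longrightarrow> b = 0"
    using E_swap[OF k \<mu>(1)] by metis
  \<comment> \<open>The case b = 0 covers ties, where no exchange of eigenvalues is available and
    E_\<nu> does not occur.\<close>
  have p: "?p ?\<nu> = ?p \<mu>" if "b \<noteq> 0"
  proof -
    have ne: "look \<mu> k \<noteq> look \<mu> (Suc k)" using ab(2) that by blast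
    have "?p ?\<nu> = (\<Prod>\<beta>\<in>set \<beta>s. root_factor \<alpha> N \<mu> (map_prod (s k) (s k) \<beta>))"
      using \<beta>s(1) by (intro prod.cong) (auto simp: root_factor_def eta_bar_swap[OF IJ_range[OF k] ne] dest!: subsetD)
    also have "\<dots> = ?p \<mu>" by (rule prod.reindex_bij_betw[OF bij])
    finally show ?thesis .
  qed
  note O = O_prod_jack[OF \<beta>s orbit_composition]
  have "O_prod \<alpha> N \<beta>s (act (s k) (E \<mu>)) = Const a * (Const (?p \<mu>) * E \<mu>) + Const b * (Const (?p ?\<nu>) * E ?\<nu>)"
    unfolding ab(1) lin_add[OF lin_O_prod] lin_scale[OF lin_O_prod] O[OF \<mu>(1)] O[OF orbit_swap[OF k \<mu>(1)]] ..
  also have "\<dots> = Const (?p \<mu>) * (Const a * E \<mu> + Const b * E ?\<nu>)"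
    using p by (cases "b = 0") (simp_all add: distrib_left mult.commute)
  finally show "O_prod \<alpha> N \<beta>s (act (s k) x) = act (s k) (O_prod \<alpha> N \<beta>s x)"
    unfolding \<mu>(2) O[OF \<mu>(1)] by (simp add: ab(1))
qed (use f in \<open>auto simp: V_def intro!: lin_comp[OF lin_O_prod lin_act] lin_comp[OF lin_act lin_O_prod]\<close>)

lemma O_prod_symmetric:
  assumes \<beta>s: "set \<beta>s = pos_roots N J" "distinct \<beta>s" and k: "k \<in> I \<union> J"
  defines "F \<equiv> jack_prescribed \<alpha> N I J \<eta>"
  shows "act (s k) (O_prod \<alpha> N \<beta>s F) = O_prod \<alpha> N \<beta>s F"
proof (cases "k \<in> J")
  case False
  \<comment> \<open>For k in I the whole set of roots is preserved, so O_J commutes with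
    s_k.\<close>
  then have "(k, Suc k) \<notin> pos_roots N J" by (subst pos_roots_iff[OF J]) auto
  then have "bij_betw (map_prod (s k) (s k)) (set \<beta>s) (set \<beta>s)"
    using pos_roots_swap[OF J IJ_cases[OF k]] \<beta>s(1) by simp
  then have "act (s k) (O_prod \<alpha> N \<beta>s F) = O_prod \<alpha> N \<beta>s (act (s k) F)"
    using \<beta>s pos_roots_range unfolding F_def by (intro O_prod_swap[symmetric] k jack_prescribed_V) auto
  then show ?thesis using False by (simp add: F_def jack_prescribed_act[OF k] chi_def)
next
  case True
  note kN = IJ_range[OF k]
  define \<gamma>s where "\<gamma>s = remove1 (k, Suc k) \<beta>s"
  have in_R: "(k, Suc k) \<in> set \<beta>s" unfolding \<beta>s(1) using True kN by (subst pos_roots_iff[OF J]) auto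
  have \<gamma>s: "set \<gamma>s = pos_roots N J - {(k, Suc k)}" "distinct \<gamma>s"
    using \<beta>s by (simp_all add: \<gamma>s_def)
  have range: "set \<gamma>s \<subseteq> {1..N} \<times> {1..N}" "set \<beta>s \<subseteq> {1..N} \<times> {1..N}"
    using \<gamma>s \<beta>s pos_roots_range[of N J] by auto
  have F: "F \<in> V" unfolding F_def by (rule jack_prescribed_V)
  define g where "g = O_prod \<alpha> N \<gamma>s F"
  \<comment> \<open>The factor of the simple root can be moved to the front because both orders act
    by the same scalar on each E_\<mu> of the orbit.\<close>
  have "O_prod \<alpha> N \<beta>s F = O_prod \<alpha> N ((k, Suc k) # \<gamma>s) F"
  proof (rule lin_eq_on_span[OF lin_O_prod lin_O_prod _ F[unfolded V_def]])
    fix x assume "x \<in> E ` orbit"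
    then obtain \<mu> where \<mu>: "\<mu> \<in> orbit" "x = E \<mu>" by blast
    have "set ((k, Suc k) # \<gamma>s) = set \<beta>s" "distinct ((k, Suc k) # \<gamma>s)"
      using \<gamma>s \<beta>s in_R by auto
    then show "O_prod \<alpha> N \<beta>s x = O_prod \<alpha> N ((k, Suc k) # \<gamma>s) x"
      using \<beta>s(2) range(2) orbit_composition[OF \<mu>(1)] unfolding \<mu>(2) by (simp only: O_prod_jack)
  qed
  then have G: "O_prod \<alpha> N \<beta>s F = Const (1 / \<alpha>) * (cherednik \<alpha> N k g - cherednik \<alpha> N (Suc k) g + g)"
    by (simp add: O_prod_Cons D_root_def g_def distrib_left)
  have "act (s k) F = - F" using True by (simp add: F_def jack_prescribed_act[OF k] chi_def)
  moreover have "bij_betw (map_prod (s k) (s k)) (set \<gamma>s) (set \<gamma>s)"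
    using pos_roots_swap[OF J IJ_cases[OF k]] by (simp only: \<gamma>s(1))
  ultimately have sg: "act (s k) g = - g"
    unfolding g_def using O_prod_swap[OF k range(1) \<gamma>s(2) _ F] by (simp add: lin_minus[OF lin_O_prod])
  have 1: "act (s k) (cherednik \<alpha> N k g) = g - cherednik \<alpha> N (Suc k) g"
    using cherednik_swap'[OF kN, of \<alpha> g] by (simp add: sg lin_minus[OF lin_cherednik] algebra_simps)
  have 2: "act (s k) (cherednik \<alpha> N (Suc k) g) = - cherednik \<alpha> N k g - g"
    using cherednik_swap[OF kN, of \<alpha> g] by (simp add: sg lin_minus[OF lin_cherednik] algebra_simps)
  show ?thesis unfolding G by (simp add: 1 2 sg)
qed

text \<open>All compositions of the orbit are below \<eta>, so z^\<eta> occurs in E_\<eta> only, and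
  its eigenvalue is the factor.\<close>

lemma O_prod_leading:
  assumes \<beta>s: "set \<beta>s \<subseteq> {1..N} \<times> {1..N}" "distinct \<beta>s" and f: "f \<in> V"
  shows "look (O_prod \<alpha> N \<beta>s f) \<eta> = (\<Prod>\<beta>\<in>set \<beta>s. root_factor \<alpha> N \<eta> \<beta>) * look f \<eta>"
  using f unfolding V_def
proof (induction rule: mpol.span_induct_alt)
  case base
  then show ?case by (simp add: lin_0[OF lin_O_prod])
next
  case (step c x y)
  then obtain \<mu> where \<mu>: "\<mu> \<in> orbit" "x = E \<mu>" by blast
  have "look (E \<mu>) \<eta> = 0" if "\<mu> \<noteq> \<eta>"
    using that jack_keys[OF \<alpha> orbit_composition[OF \<mu>(1)], of \<eta>] below_antisym[OF orbit_below[OF \<mu>(1)]]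
    by (auto simp: in_keys_iff)
  then have "look (O_prod \<alpha> N \<beta>s x) \<eta> = (\<Prod>\<beta>\<in>set \<beta>s. root_factor \<alpha> N \<eta> \<beta>) * look x \<eta>"
    unfolding \<mu>(2) O_prod_jack[OF \<beta>s orbit_composition[OF \<mu>(1)]] by (cases "\<mu> = \<eta>") auto
  then show ?case
    using step by (simp add: lin_add[OF lin_O_prod] lin_scale[OF lin_O_prod] lookup_add distrib_left mult.left_commute[of c])
qed

end

theorem proposition3p1:
  fixes \<alpha> :: real and N :: nat and I J :: "nat set" and \<eta> :: comp
    and \<beta>s :: "(nat \<times> nat) list"
  assumes "N \<ge> 1" and "\<alpha> > 0"
    and "I \<subseteq> {1..N - 1}" and "J \<subseteq> {1..N - 1}" and "I \<inter> J = {}"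
    and "\<forall>i\<in>I. i - 1 \<notin> J \<and> i + 1 \<notin> J"
    and "\<forall>j\<in>J. j - 1 \<notin> I \<and> j + 1 \<notin> I"
    and "composition N \<eta>"
    and "\<forall>i\<in>I. Poly_Mapping.lookup \<eta> i \<ge> Poly_Mapping.lookup \<eta> (i + 1)"
    and "\<forall>j\<in>J. Poly_Mapping.lookup \<eta> j > Poly_Mapping.lookup \<eta> (j + 1)"
    and "distinct \<beta>s" and "set \<beta>s = pos_roots N J"
  shows "(\<forall>i\<in>I \<union> J. swap_vars i (i + 1) (O_prod \<alpha> N \<beta>s (jack_prescribed \<alpha> N I J \<eta>))
             = O_prod \<alpha> N \<beta>s (jack_prescribed \<alpha> N I J \<eta>))
       \<and> O_prod \<alpha> N \<beta>s (jack_prescribed \<alpha> N I J \<eta>)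
             = Const (c_coeff \<alpha> N J \<eta>) * jack_prescribed \<alpha> N (I \<union> J) {} \<eta>"
proof -
  interpret A: symmetry_data \<alpha> N I J \<eta>
    using assms by unfold_locales auto
  interpret B: symmetry_data \<alpha> N "I \<union> J" "{}" \<eta>
    using assms by unfold_locales (auto simp: less_imp_le)
  let ?F = "jack_prescribed \<alpha> N I J \<eta>" and ?S = "jack_prescribed \<alpha> N (I \<union> J) {} \<eta>"
  let ?G = "O_prod \<alpha> N \<beta>s ?F" and ?c = "c_coeff \<alpha> N J \<eta>"
  have sym: "act (transpose k (Suc k)) ?G = ?G" if "k \<in> I \<union> J" for k
    by (rule A.O_prod_symmetric[OF assms(12,11) that])
  have range: "set \<beta>s \<subseteq> {1..N} \<times> {1..N}" using pos_roots_range assms(12) by simp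
  \<comment> \<open>Both instances generate the same group, hence the same orbit and the same
    span.\<close>
  have S: "?S \<in> A.V" using B.jack_prescribed_V by (simp add: A.V_def B.V_def A.orbit_def B.orbit_def)
  \<comment> \<open>Both polynomials are fixed by all generators and lie in one span, so equality of
    their coefficients at \<eta> decides.\<close>
  have "?G - Const ?c * ?S = 0"
  proof (rule A.V_eq_0)
    show "?G - Const ?c * ?S \<in> A.V"
      by (intro A.V_diff A.V_scale S A.V_O_prod range assms(11) A.jack_prescribed_V)
    show "act (transpose k (Suc k)) (?G - Const ?c * ?S) = Const 1 * (?G - Const ?c * ?S)" if "k \<in> I \<union> J" for k
      using sym[OF that] B.jack_prescribed_act[of k] that by (simp add: B.chi_def)
    have "(\<Prod>\<beta>\<in>set \<beta>s. root_factor \<alpha> N \<eta> \<beta>) = ?c"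
      by (simp add: c_coeff_def root_factor_def assms(12))
    then show "look (?G - Const ?c * ?S) \<eta> = 0"
      using A.O_prod_leading[OF range assms(11) A.jack_prescribed_V] A.jack_prescribed_look B.jack_prescribed_look
      by (simp add: lookup_minus)
  qed
  then show ?thesis using sym by (simp add: swap_vars_act)
qed

end
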